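(* Let $S$ be any semiring, and let $X$ be a Boolean space. Then $\widehat{\mathbf{S}}X$ is the free profinite $S$-semimodule on the Boolean space $X$. That is, $\widehat{\mathbf{S}}X$, with its canonical $S$-semimodule structure, is a profinite $S$-semimodule, and for every profinite $S$-semimodule $Y$ and every continuous map $f\colon X\to Y$ there is a unique continuous $S$-semimodule homomorphism $g\colon\widehat{\mathbf{S}}X\to Y$ with $g\circ\widehat{\eta}_X=f$.
   Context: A Boolean space is a compact Hausdorff space admitting a basis of clopen sets; $\mathbf{BStone}$ is the category of Boolean spaces and continuous maps, and $|-|\colon\mathbf{BStone}\to\mathbf{Set}$ the underlying-set functor. A semiring $S=(S,+,\cdot,0,1)$ consists of a commutative monoid $(S,+,0)$ and a monoid $(S,\cdot,1)$ such that $\cdot$ distributes over $+$ on both sides and $s\cdot 0=0=0\cdot s$. An $S$-semimodule is a commutative monoid $(M,+,0)$ with a scalar multiplication $S\times M\to M$ satisfying $s(m+n)=sm+sn$, $(s+t)m=sm+tm$, $(s\cdot t)m=s(tm)$, $1m=m$, $0m=0=s0$. The semiring monad $\mathbf{S}$ on $\mathbf{Set}$ sends a set $X$ to the set $\mathbf{S}X$ of finitely supported functions $X\to S$ (formal sums $\sum s_ix_i$), and $\phi\colon X\to Y$ to $\sum s_ix_i\mapsto\sum s_i\phi(x_i)$; its unit sends $x$ to the characteristic function of $\{x\}$, and its multiplication sends $\sum s_if_i$ to $x\mapsto\sum s_if_i(x)$. Its Eilenberg–Moore algebras are exactly the $S$-semimodules. Let $G$ be the functor from finite $S$-semimodules and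 homomorphisms to $\mathbf{BStone}$ sending $Y$ to its underlying set with the discrete topology. The profinite monad $\widehat{\mathbf{S}}=(\widehat{\mathbf{S}},\widehat{\eta},\widehat{\mu})$ is the codensity monad of $G$. Explicitly, $\widehat{\mathbf{S}}X$ is the limit in $\mathbf{BStone}$ of the finite discrete spaces $Y$ over the comma category $X\downarrow G$, whose objects are pairs $(\phi,Y)$ with $Y$ a finite $S$-semimodule and $\phi\colon X\to Y$ continuous, and whose morphisms $(\phi_1,Y_1)\to(\phi_2,Y_2)$ are homomorphisms $m\colon Y_1\to Y_2$ with $m\circ\phi_1=\phi_2$. Write $\pi^X_\phi\colon\widehat{\mathbf{S}}X\to Y$ for the limit projections. Then $\widehat{\eta}_X\colon X\to\widehat{\mathbf{S}}X$ is determined by $\pi^X_\phi\circ\widehat{\eta}_X=\phi$ and $\widehat{\mu}_X\colon\widehat{\mathbf{S}}^2X\to\widehat{\mathbf{S}}X$ by $\pi^X_\phi\circ\widehat{\mu}_X=\pi^{\widehat{\mathbf{S}}X}_{\pi^X_\phi}$. The map $\tau_X\colon\mathbf{S}|X|\to|\widehat{\mathbf{S}}X|$ is the unique one such that $\pi^X_\phi\circ\tau_X$ is the function $\sum s_ix_i\mapsto\sum s_i\phi(x_i)$ (evaluated in $Y$) for all $(\phi,Y)$. The canonical $S$-semimodule structure on $\widehat{\mathbf{S}}X$ is the one given by the $\mathbf{S}$-algebra structure map $|\widehat{\mu}_X|\circ\tau_{\widehat{\mathbf{S}}X}\colon\mathbf{S}|\widehat{\mathbf{S}}X|\to|\widehat{\mathbf{S}}X|$.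 A profinite $S$-semimodule is an $S$-semimodule $Y$ carrying a Boolean topology such that there exist a codirected diagram of finite discrete $S$-semimodules $Y_i$ and a cone of continuous homomorphisms $Y\to Y_i$ which is a limit cone in $\mathbf{BStone}$. Morphisms are continuous homomorphisms. *)

theory Defs
  imports "HOL-Analysis.Analysis" "HOL-Algebra.Module"
begin

section \<open>Boolean spaces and limits of topological spaces\<close>

definition boolean_space :: "'a topology \<Rightarrow> bool" where
  "boolean_space X \<longleftrightarrow> compact_space X \<and> Hausdorff_space X \<and>
     (\<exists>B. (\<forall>U\<in>B. openin X U \<and> closedin X U) \<and> openin X = arbitrary union_of (\<lambda>U. U \<in> B))"

text \<open>
  A diagram has objects \<open>D i\<close> for \<open>i \<in> I\<close>, and \<open>A i j m\<close> says that \<open>m\<close> is one of its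
  arrows from \<open>D i\<close> to \<open>D j\<close>. The limit in \<open>BStone\<close> of a diagram of Boolean spaces is the space
  of compatible families, topologised as a subspace of the product.
\<close>

definition limit_space ::
  "'i set \<Rightarrow> ('i \<Rightarrow> 'c topology) \<Rightarrow> ('i \<Rightarrow> 'i \<Rightarrow> ('c \<Rightarrow> 'c) \<Rightarrow> bool) \<Rightarrow> ('i \<Rightarrow> 'c) topology" where
  "limit_space I D A = subtopology (product_topology D I)
     {t. \<forall>i\<in>I. \<forall>j\<in>I. \<forall>m. A i j m \<longrightarrow> m (t i) = t j}"

definition cone ::
  "'i set \<Rightarrow> ('i \<Rightarrow> 'c topology) \<Rightarrow> ('i \<Rightarrow> 'i \<Rightarrow> ('c \<Rightarrow> 'c) \<Rightarrow> bool) \<Rightarrow>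
   'z topology \<Rightarrow> ('i \<Rightarrow> 'z \<Rightarrow> 'c) \<Rightarrow> bool" where
  "cone I D A Z q \<longleftrightarrow> (\<forall>i\<in>I. continuous_map Z (D i) (q i)) \<and>
     (\<forall>i\<in>I. \<forall>j\<in>I. \<forall>m. A i j m \<longrightarrow> (\<forall>z\<in>topspace Z. m (q i z) = q j z))"

text \<open>
  A cone is a limit cone iff its comparison map to the space of compatible families is an
  isomorphism. The universal property, which as a definition would have to quantify over spaces of
  all types, is derived below as \<open>limit_cone_universal\<close>.
\<close>

definition limit_cone ::
  "'i set \<Rightarrow> ('i \<Rightarrow> 'c topology) \<Rightarrow> ('i \<Rightarrow> 'i \<Rightarrow> ('c \<Rightarrow> 'c) \<Rightarrow> bool) \<Rightarrow>
   'z topology \<Rightarrow> ('i \<Rightarrow> 'z \<Rightarrow> 'c) \<Rightarrow> bool" where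
  "limit_cone I D A Z q \<longleftrightarrow> cone I D A Z q \<and>
     homeomorphic_map Z (limit_space I D A) (\<lambda>z. \<lambda>i\<in>I. q i z)"

lemma topspace_limit_space:
  "t \<in> topspace (limit_space I D A) \<longleftrightarrow>
     t \<in> (\<Pi>\<^sub>E i\<in>I. topspace (D i)) \<and> (\<forall>i\<in>I. \<forall>j\<in>I. \<forall>m. A i j m \<longrightarrow> m (t i) = t j)"
  by (auto simp: limit_space_def)

lemma cone_tuple_continuous:
  assumes "cone I D A Z q"
  shows "continuous_map Z (limit_space I D A) (\<lambda>z. \<lambda>i\<in>I. q i z)"
proof -
  have "continuous_map Z (D k) (\<lambda>z. (\<lambda>i\<in>I. q i z) k)" if "k \<in> I" for k
    using assms that by (simp add: cone_def)
  then show ?thesis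
    using assms
    by (auto simp: cone_def limit_space_def continuous_map_in_subtopology
        continuous_map_componentwise)
qed

lemma limit_cone_universal:
  assumes L: "limit_cone I D A T p" and Z: "cone I D A Z q"
  shows "\<exists>!g. g \<in> extensional (topspace Z) \<and> continuous_map Z T g \<and>
           (\<forall>i\<in>I. \<forall>z\<in>topspace Z. p i (g z) = q i z)"
proof -
  let ?c = "\<lambda>y. \<lambda>i\<in>I. p i y"
  have "homeomorphic_map T (limit_space I D A) ?c"
    using L by (simp add: limit_cone_def)
  then obtain h where h: "homeomorphic_maps T (limit_space I D A) ?c h"
    using homeomorphic_map_maps by blast
  have hc: "continuous_map (limit_space I D A) T h"
    and hl: "\<And>y. y \<in> topspace T \<Longrightarrow> h (?c y) = y"
    and hr: "\<And>t. t \<in> topspace (limit_space I D A) \<Longrightarrow> ?c (h t) = t"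
    using h by (auto simp: homeomorphic_maps_def)
  let ?q = "\<lambda>z. \<lambda>i\<in>I. q i z"
  have qc: "continuous_map Z (limit_space I D A) ?q"
    by (rule cone_tuple_continuous[OF Z])
  let ?g = "restrict (h \<circ> ?q) (topspace Z)"
  have gc: "continuous_map Z T ?g"
    using continuous_map_compose[OF qc hc] by (rule continuous_map_eq) auto
  have gp: "p i (?g z) = q i z" if "i \<in> I" "z \<in> topspace Z" for i z
  proof -
    have "?c (h (?q z)) = ?q z"
      using hr continuous_map_image_subset_topspace[OF qc] that by blast
    then have "?c (h (?q z)) i = ?q z i" by (rule fun_cong)
    then show ?thesis using that by simp
  qed
  show ?thesis
  proof (rule ex1I[of _ ?g])
    fix g assume g: "g \<in> extensional (topspace Z) \<and> continuous_map Z T g \<and>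
           (\<forall>i\<in>I. \<forall>z\<in>topspace Z. p i (g z) = q i z)"
    show "g = ?g"
    proof (rule extensionalityI[of _ "topspace Z"])
      fix z assume z: "z \<in> topspace Z"
      then have "g z \<in> topspace T"
        using g continuous_map_image_subset_topspace by blast
      then have "g z = h (?c (g z))" by (simp add: hl)
      also have "?c (g z) = ?q z" using g z by (auto intro: restrict_ext)
      finally show "g z = ?g z" using z by (simp add: o_def restrict_def)
    qed (use g in auto)
  qed (use gc gp in auto)
qed


section \<open>Semimodules\<close>

text \<open>
  Semimodules use the record of \<open>HOL-Algebra\<close> modules, whose \<open>mult\<close> and \<open>one\<close> fields carry no
  meaning.
\<close>

locale semimodule = S?: semiring S + M?: abelian_monoid M
  for S :: "('s, 'e) ring_scheme" (structure) and M :: "('s, 'm, 'f) module_scheme" (structure) +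
  assumes smult_closed: "\<lbrakk>s \<in> carrier S; x \<in> carrier M\<rbrakk> \<Longrightarrow> s \<odot>\<^bsub>M\<^esub> x \<in> carrier M"
    and smult_r_distr: "\<lbrakk>s \<in> carrier S; x \<in> carrier M; y \<in> carrier M\<rbrakk> \<Longrightarrow>
      s \<odot>\<^bsub>M\<^esub> (x \<oplus>\<^bsub>M\<^esub> y) = s \<odot>\<^bsub>M\<^esub> x \<oplus>\<^bsub>M\<^esub> s \<odot>\<^bsub>M\<^esub> y"
    and smult_l_distr: "\<lbrakk>s \<in> carrier S; t \<in> carrier S; x \<in> carrier M\<rbrakk> \<Longrightarrow>
      (s \<oplus>\<^bsub>S\<^esub> t) \<odot>\<^bsub>M\<^esub> x = s \<odot>\<^bsub>M\<^esub> x \<oplus>\<^bsub>M\<^esub> t \<odot>\<^bsub>M\<^esub> x"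
    and smult_assoc: "\<lbrakk>s \<in> carrier S; t \<in> carrier S; x \<in> carrier M\<rbrakk> \<Longrightarrow>
      (s \<otimes>\<^bsub>S\<^esub> t) \<odot>\<^bsub>M\<^esub> x = s \<odot>\<^bsub>M\<^esub> (t \<odot>\<^bsub>M\<^esub> x)"
    and smult_one: "x \<in> carrier M \<Longrightarrow> \<one>\<^bsub>S\<^esub> \<odot>\<^bsub>M\<^esub> x = x"
    and smult_l_null: "x \<in> carrier M \<Longrightarrow> \<zero>\<^bsub>S\<^esub> \<odot>\<^bsub>M\<^esub> x = \<zero>\<^bsub>M\<^esub>"
    and smult_r_null: "s \<in> carrier S \<Longrightarrow> s \<odot>\<^bsub>M\<^esub> \<zero>\<^bsub>M\<^esub> = \<zero>\<^bsub>M\<^esub>"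

definition semimodule_hom ::
  "('s, 'e) ring_scheme \<Rightarrow> ('s, 'm, 'f) module_scheme \<Rightarrow> ('s, 'n, 'g) module_scheme \<Rightarrow>
   ('m \<Rightarrow> 'n) set" where
  "semimodule_hom S M N = {h \<in> carrier M \<rightarrow> carrier N.
     (\<forall>x\<in>carrier M. \<forall>y\<in>carrier M. h (x \<oplus>\<^bsub>M\<^esub> y) = h x \<oplus>\<^bsub>N\<^esub> h y) \<and>
     h \<zero>\<^bsub>M\<^esub> = \<zero>\<^bsub>N\<^esub> \<and>
     (\<forall>s\<in>carrier S. \<forall>x\<in>carrier M. h (s \<odot>\<^bsub>M\<^esub> x) = s \<odot>\<^bsub>N\<^esub> h x)}"

text \<open>
  Finite semimodules are represented, up to isomorphism, by those carried by finite sets of natural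
  numbers. Records which differ only in values outside the carrier or in the unused fields are
  isomorphic via the identity, so such duplicates do not affect limits.
\<close>

definition finite_semimodules :: "('s, 'e) ring_scheme \<Rightarrow> ('s, nat) module set" where
  "finite_semimodules S = {Y. semimodule S Y \<and> finite (carrier Y)}"

abbreviation discrete_space :: "('s, 'm, 'f) module_scheme \<Rightarrow> 'm topology" where
  "discrete_space Y \<equiv> discrete_topology (carrier Y)"


section \<open>Profinite semimodules\<close>

text \<open>
  For \<open>(i, j) \<in> r\<close>, that is \<open>i \<le> j\<close>, the transition map \<open>tr i j\<close> goes from \<open>Y i\<close> to \<open>Y j\<close>.
\<close>

definition codirected_diagram ::
  "('s, 'e) ring_scheme \<Rightarrow> 'i set \<Rightarrow> 'i rel \<Rightarrow> ('i \<Rightarrow> ('s, nat) module) \<Rightarrow>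
   ('i \<Rightarrow> 'i \<Rightarrow> nat \<Rightarrow> nat) \<Rightarrow> bool" where
  "codirected_diagram S J r Y tr \<longleftrightarrow>
     partial_order_on J r \<and> J \<noteq> {} \<and> (\<forall>i\<in>J. \<forall>j\<in>J. \<exists>k\<in>J. (k, i) \<in> r \<and> (k, j) \<in> r) \<and>
     (\<forall>i\<in>J. Y i \<in> finite_semimodules S) \<and>
     (\<forall>i j. (i, j) \<in> r \<longrightarrow> tr i j \<in> semimodule_hom S (Y i) (Y j)) \<and>
     (\<forall>i\<in>J. \<forall>y\<in>carrier (Y i). tr i i y = y) \<and>
     (\<forall>i j k. (i, j) \<in> r \<longrightarrow> (j, k) \<in> r \<longrightarrow> (\<forall>y\<in>carrier (Y i). tr j k (tr i j y) = tr i k y))"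

text \<open>
  The first argument only fixes the type from which the indices of the diagram are drawn. For a
  semimodule with elements of type \<open>'m\<close>, the type \<open>('m \<times> 'm) set\<close> is always large enough: one may
  index by the semimodule congruences with finitely many classes, all clopen.
\<close>

definition profinite_semimodule ::
  "'i itself \<Rightarrow> ('s, 'e) ring_scheme \<Rightarrow> ('s, 'm, 'f) module_scheme \<Rightarrow> 'm topology \<Rightarrow> bool" where
  "profinite_semimodule _ S M T \<longleftrightarrow>
     semimodule S M \<and> boolean_space T \<and> topspace T = carrier M \<and>
     (\<exists>(J :: 'i set) r Y tr p. codirected_diagram S J r Y tr \<and>
        (\<forall>i\<in>J. p i \<in> semimodule_hom S M (Y i)) \<and>
        limit_cone J (\<lambda>i. discrete_space (Y i)) (\<lambda>i j m. (i, j) \<in> r \<and> m = tr i j) T p)"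


section \<open>The semiring monad\<close>

definition formal_sums :: "('s, 'e) ring_scheme \<Rightarrow> 'a set \<Rightarrow> ('a \<Rightarrow> 's) set" where
  "formal_sums S A = {f \<in> A \<rightarrow>\<^sub>E carrier S. finite {x \<in> A. f x \<noteq> \<zero>\<^bsub>S\<^esub>}}"

definition formal_unit :: "('s, 'e) ring_scheme \<Rightarrow> 'a set \<Rightarrow> 'a \<Rightarrow> 'a \<Rightarrow> 's" where
  "formal_unit S A x = (\<lambda>y\<in>A. if y = x then \<one>\<^bsub>S\<^esub> else \<zero>\<^bsub>S\<^esub>)"

text \<open>The value in \<open>Y\<close> of the formal sum \<open>\<Sum> s\<^sub>i \<phi>(x\<^sub>i)\<close>, where \<open>f = \<Sum> s\<^sub>i x\<^sub>i\<close>.\<close>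

definition formal_eval ::
  "('s, 'e) ring_scheme \<Rightarrow> ('s, 'm, 'f) module_scheme \<Rightarrow> 'a set \<Rightarrow> ('a \<Rightarrow> 'm) \<Rightarrow> ('a \<Rightarrow> 's) \<Rightarrow> 'm" where
  "formal_eval S Y A \<phi> f = (\<Oplus>\<^bsub>Y\<^esub>x\<in>{x \<in> A. f x \<noteq> \<zero>\<^bsub>S\<^esub>}. f x \<odot>\<^bsub>Y\<^esub> \<phi> x)"

text \<open>
  The semimodule corresponding to an Eilenberg--Moore algebra \<open>\<alpha>\<close> on \<open>A\<close>: its operations are the
  values of \<open>\<alpha>\<close> at the formal sums \<open>0\<close>, \<open>1x + 1y\<close> and \<open>sx\<close>.
\<close>

definition algebra_semimodule ::
  "('s, 'e) ring_scheme \<Rightarrow> 'a set \<Rightarrow> (('a \<Rightarrow> 's) \<Rightarrow> 'a) \<Rightarrow> ('s, 'a) module" where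
  "algebra_semimodule S A \<alpha> =
     \<lparr>carrier = A,
      mult = (\<lambda>x y. undefined),
      one = undefined,
      zero = \<alpha> (\<lambda>z\<in>A. \<zero>\<^bsub>S\<^esub>),
      add = (\<lambda>x y. \<alpha> (\<lambda>z\<in>A. formal_unit S A x z \<oplus>\<^bsub>S\<^esub> formal_unit S A y z)),
      smult = (\<lambda>s x. \<alpha> (\<lambda>z\<in>A. s \<otimes>\<^bsub>S\<^esub> formal_unit S A x z))\<rparr>"


section \<open>The profinite monad\<close>

type_synonym ('s, 'x) comma_obj = "('x \<Rightarrow> nat) \<times> ('s, nat) module"
type_synonym ('s, 'x) profinite_point = "('s, 'x) comma_obj \<Rightarrow> nat"

definition comma_objects ::
  "('s, 'e) ring_scheme \<Rightarrow> 'x topology \<Rightarrow> ('s, 'x) comma_obj set" where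
  "comma_objects S X = {(\<phi>, Y). Y \<in> finite_semimodules S \<and>
     \<phi> \<in> extensional (topspace X) \<and> continuous_map X (discrete_space Y) \<phi>}"

definition comma_arrow ::
  "('s, 'e) ring_scheme \<Rightarrow> 'x topology \<Rightarrow> ('s, 'x) comma_obj \<Rightarrow> ('s, 'x) comma_obj \<Rightarrow>
   (nat \<Rightarrow> nat) \<Rightarrow> bool" where
  "comma_arrow S X = (\<lambda>(\<phi>\<^sub>1, Y\<^sub>1) (\<phi>\<^sub>2, Y\<^sub>2) m.
     m \<in> semimodule_hom S Y\<^sub>1 Y\<^sub>2 \<and> (\<forall>x\<in>topspace X. m (\<phi>\<^sub>1 x) = \<phi>\<^sub>2 x))"

definition Shat ::
  "('s, 'e) ring_scheme \<Rightarrow> 'x topology \<Rightarrow> ('s, 'x) profinite_point topology" where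
  "Shat S X = limit_space (comma_objects S X) (\<lambda>(\<phi>, Y). discrete_space Y) (comma_arrow S X)"

definition Shat_proj ::
  "('s, 'e) ring_scheme \<Rightarrow> 'x topology \<Rightarrow> ('s, 'x) comma_obj \<Rightarrow> ('s, 'x) profinite_point \<Rightarrow> nat" where
  "Shat_proj S X i = (\<lambda>t\<in>topspace (Shat S X). t i)"

text \<open>
  A map into \<open>Shat S X\<close> is determined by its composites with the projections. Each of the
  following three maps lists these composites as the components of the compatible family.
\<close>

definition Shat_unit ::
  "('s, 'e) ring_scheme \<Rightarrow> 'x topology \<Rightarrow> 'x \<Rightarrow> ('s, 'x) profinite_point" where
  "Shat_unit S X = (\<lambda>x\<in>topspace X. \<lambda>(\<phi>, Y)\<in>comma_objects S X. \<phi> x)"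

definition Shat_mult ::
  "('s, 'e) ring_scheme \<Rightarrow> 'x topology \<Rightarrow>
   ('s, ('s, 'x) profinite_point) profinite_point \<Rightarrow> ('s, 'x) profinite_point" where
  "Shat_mult S X = (\<lambda>u\<in>topspace (Shat S (Shat S X)). \<lambda>(\<phi>, Y)\<in>comma_objects S X.
     Shat_proj S (Shat S X) (Shat_proj S X (\<phi>, Y), Y) u)"

definition Shat_tau ::
  "('s, 'e) ring_scheme \<Rightarrow> 'x topology \<Rightarrow> ('x \<Rightarrow> 's) \<Rightarrow> ('s, 'x) profinite_point" where
  "Shat_tau S X = (\<lambda>f\<in>formal_sums S (topspace X). \<lambda>(\<phi>, Y)\<in>comma_objects S X.
     formal_eval S Y (topspace X) \<phi> f)"

lemma topspace_Shat:
  "t \<in> topspace (Shat S X) \<longleftrightarrow>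
     t \<in> extensional (comma_objects S X) \<and>
     (\<forall>\<phi> Y. (\<phi>, Y) \<in> comma_objects S X \<longrightarrow> t (\<phi>, Y) \<in> carrier Y) \<and>
     (\<forall>\<phi> Y \<psi> Z m. (\<phi>, Y) \<in> comma_objects S X \<longrightarrow> (\<psi>, Z) \<in> comma_objects S X \<longrightarrow>
        comma_arrow S X (\<phi>, Y) (\<psi>, Z) m \<longrightarrow> m (t (\<phi>, Y)) = t (\<psi>, Z))"
  unfolding Shat_def topspace_limit_space PiE_iff by auto

lemma Shat_unit_continuous: "continuous_map X (Shat S X) (Shat_unit S X)"
proof -
  have "cone (comma_objects S X) (\<lambda>(\<phi>, Y). discrete_space Y) (comma_arrow S X) X (\<lambda>(\<phi>, Y). \<phi>)"
    by (auto simp: cone_def comma_objects_def comma_arrow_def)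
  from cone_tuple_continuous[OF this] show ?thesis
    unfolding Shat_def
    by (rule continuous_map_eq) (auto simp: Shat_unit_def intro!: restrict_ext)
qed

lemma Shat_proj_comma_object:
  assumes "(\<phi>, Y) \<in> comma_objects S X"
  shows "(Shat_proj S X (\<phi>, Y), Y) \<in> comma_objects S (Shat S X)"
proof -
  have "continuous_map (Shat S X) (discrete_space Y) (\<lambda>t. t (\<phi>, Y))"
    unfolding Shat_def limit_space_def
    using continuous_map_product_projection[OF assms,
        of "\<lambda>(\<phi>, Y). discrete_space Y"]
    by (intro continuous_map_from_subtopology) simp
  then have "continuous_map (Shat S X) (discrete_space Y) (Shat_proj S X (\<phi>, Y))"
    by (rule continuous_map_eq) (auto simp: Shat_proj_def)
  then show ?thesis
    using assms by (auto simp: comma_objects_def Shat_proj_def)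
qed

lemma Shat_mult_closed:
  assumes u: "u \<in> topspace (Shat S (Shat S X))"
  shows "Shat_mult S X u \<in> topspace (Shat S X)"
proof -
  have arr: "comma_arrow S (Shat S X) (Shat_proj S X (\<phi>, Y), Y) (Shat_proj S X (\<psi>, Z), Z) m"
    if "(\<phi>, Y) \<in> comma_objects S X" "(\<psi>, Z) \<in> comma_objects S X"
      "comma_arrow S X (\<phi>, Y) (\<psi>, Z) m" for m \<phi> Y \<psi> Z
  proof -
    have "m (t (\<phi>, Y)) = t (\<psi>, Z)" if "t \<in> topspace (Shat S X)" for t
      using that \<open>(\<phi>, Y) \<in> _\<close> \<open>(\<psi>, Z) \<in> _\<close> \<open>comma_arrow S X _ _ m\<close> unfolding topspace_Shat by blast
    then show ?thesis
      using \<open>comma_arrow S X _ _ m\<close> by (simp add: comma_arrow_def Shat_proj_def)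
  qed
  have "u (Shat_proj S X (\<phi>, Y), Y) \<in> carrier Y" if "(\<phi>, Y) \<in> comma_objects S X" for \<phi> Y
    using u Shat_proj_comma_object[OF that] unfolding topspace_Shat[of u] by blast
  moreover have "m (u (Shat_proj S X (\<phi>, Y), Y)) = u (Shat_proj S X (\<psi>, Z), Z)"
    if "(\<phi>, Y) \<in> comma_objects S X" "(\<psi>, Z) \<in> comma_objects S X"
      "comma_arrow S X (\<phi>, Y) (\<psi>, Z) m" for m \<phi> Y \<psi> Z
    using u Shat_proj_comma_object[OF that(1)] Shat_proj_comma_object[OF that(2)] arr[OF that]
    unfolding topspace_Shat[of u] by blast
  moreover have "Shat_mult S X u =
      (\<lambda>(\<phi>, Y)\<in>comma_objects S X. u (Shat_proj S X (\<phi>, Y), Y))"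
    using u by (simp add: Shat_mult_def Shat_proj_def[of S "Shat S X"])
  ultimately show ?thesis
    unfolding topspace_Shat[of "Shat_mult S X u"] by simp
qed

lemma semimodule_hom_formal_eval:
  assumes Y: "semimodule S Y" and Z: "semimodule S Z" and m: "m \<in> semimodule_hom S Y Z"
    and \<phi>: "\<phi> \<in> A \<rightarrow> carrier Y" and f: "f \<in> formal_sums S A"
  shows "formal_eval S Y A \<phi> f \<in> carrier Y"
    and "m (formal_eval S Y A \<phi> f) = formal_eval S Z A (m \<circ> \<phi>) f"
proof -
  interpret Y: semimodule S Y by (rule Y)
  interpret Z: semimodule S Z by (rule Z)
  have "(\<Oplus>\<^bsub>Y\<^esub>x\<in>F. f x \<odot>\<^bsub>Y\<^esub> \<phi> x) \<in> carrier Y \<and>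
      m (\<Oplus>\<^bsub>Y\<^esub>x\<in>F. f x \<odot>\<^bsub>Y\<^esub> \<phi> x) = (\<Oplus>\<^bsub>Z\<^esub>x\<in>F. f x \<odot>\<^bsub>Z\<^esub> m (\<phi> x))"
    if "finite F" "F \<subseteq> A" for F
    using that
  proof (induction F)
    case empty
    then show ?case using m by (auto simp: semimodule_hom_def)
  next
    case (insert x F)
    have 1: "f y \<in> carrier S" "\<phi> y \<in> carrier Y" "m (\<phi> y) \<in> carrier Z" if "y \<in> A" for y
      using that f \<phi> m by (auto simp: formal_sums_def semimodule_hom_def)
    then have 2: "f y \<odot>\<^bsub>Y\<^esub> \<phi> y \<in> carrier Y" "f y \<odot>\<^bsub>Z\<^esub> m (\<phi> y) \<in> carrier Z"
      "m (f y \<odot>\<^bsub>Y\<^esub> \<phi> y) = f y \<odot>\<^bsub>Z\<^esub> m (\<phi> y)" if "y \<in> A" for y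
      using that m Y.smult_closed Z.smult_closed by (auto simp: semimodule_hom_def)
    have Ysum: "(\<Oplus>\<^bsub>Y\<^esub>x\<in>insert x F. f x \<odot>\<^bsub>Y\<^esub> \<phi> x) = f x \<odot>\<^bsub>Y\<^esub> \<phi> x \<oplus>\<^bsub>Y\<^esub> (\<Oplus>\<^bsub>Y\<^esub>x\<in>F. f x \<odot>\<^bsub>Y\<^esub> \<phi> x)"
      using insert 2 by (intro Y.finsum_insert) auto
    have Zsum: "(\<Oplus>\<^bsub>Z\<^esub>x\<in>insert x F. f x \<odot>\<^bsub>Z\<^esub> m (\<phi> x)) =
        f x \<odot>\<^bsub>Z\<^esub> m (\<phi> x) \<oplus>\<^bsub>Z\<^esub> (\<Oplus>\<^bsub>Z\<^esub>x\<in>F. f x \<odot>\<^bsub>Z\<^esub> m (\<phi> x))"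
      using insert 2 by (intro Z.finsum_insert) auto
    show ?case
      unfolding Ysum Zsum using insert 2 m by (auto simp: semimodule_hom_def)
  qed
  from this[of "{x \<in> A. f x \<noteq> \<zero>\<^bsub>S\<^esub>}"] f
  show "formal_eval S Y A \<phi> f \<in> carrier Y"
    and "m (formal_eval S Y A \<phi> f) = formal_eval S Z A (m \<circ> \<phi>) f"
    by (auto simp: formal_eval_def formal_sums_def)
qed

lemma Shat_tau_closed:
  assumes f: "f \<in> formal_sums S (topspace X)"
  shows "Shat_tau S X f \<in> topspace (Shat S X)"
proof -
  have c: "semimodule S Y" "\<phi> \<in> topspace X \<rightarrow> carrier Y" if "(\<phi>, Y) \<in> comma_objects S X" for \<phi> Y
    using that continuous_map_image_subset_topspace[of X "discrete_space Y" \<phi>]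
    by (auto simp: comma_objects_def finite_semimodules_def)
  have "formal_eval S Y (topspace X) \<phi> f \<in> carrier Y" if "(\<phi>, Y) \<in> comma_objects S X" for \<phi> Y
    using semimodule_hom_formal_eval(1)[of S Y Y id, OF _ _ _ _ f] c[OF that]
    by (simp add: semimodule_hom_def)
  moreover have "m (formal_eval S Y (topspace X) \<phi> f) = formal_eval S Z (topspace X) \<psi> f"
    if "(\<phi>, Y) \<in> comma_objects S X" "(\<psi>, Z) \<in> comma_objects S X"
      "comma_arrow S X (\<phi>, Y) (\<psi>, Z) m" for m \<phi> Y \<psi> Z
  proof -
    interpret Z: semimodule S Z using c that by blast
    have "m (formal_eval S Y (topspace X) \<phi> f) = formal_eval S Z (topspace X) (m \<circ> \<phi>) f"
      using c that f by (intro semimodule_hom_formal_eval(2)) (auto simp: comma_arrow_def)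
    also have "\<dots> = formal_eval S Z (topspace X) \<psi> f"
      unfolding formal_eval_def
    proof (rule Z.finsum_cong')
      show "(\<lambda>x. f x \<odot>\<^bsub>Z\<^esub> \<psi> x) \<in> {x \<in> topspace X. f x \<noteq> \<zero>\<^bsub>S\<^esub>} \<rightarrow> carrier Z"
        using f c(2)[OF that(2)] by (auto simp: formal_sums_def intro!: Z.smult_closed)
    qed (use that in \<open>auto simp: comma_arrow_def\<close>)
    finally show ?thesis .
  qed
  ultimately show ?thesis
    using f by (simp add: topspace_Shat Shat_tau_def)
qed

definition Shat_semimodule ::
  "('s, 'e) ring_scheme \<Rightarrow> 'x topology \<Rightarrow> ('s, ('s, 'x) profinite_point) module" where
  "Shat_semimodule S X =
     algebra_semimodule S (topspace (Shat S X)) (Shat_mult S X \<circ> Shat_tau S (Shat S X))"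

end

theory Submission
  imports Defs
begin

text \<open>
  The operations of \<open>Shat S X\<close> are computed coordinatewise. Its points are separated by continuous
  homomorphisms to finite semimodules, and by compactness this makes a Boolean semimodule the limit
  of its finite continuous quotients. A continuous map from \<open>X\<close> to a limit of finite semimodules
  \<open>N i\<close> is a compatible family of objects of the comma category, whose coordinates form the
  extension to \<open>Shat S X\<close>. The extension is unique because a subsemimodule \<open>E\<close> containing the image
  of the unit is dense: the image of \<open>E\<close> in any finite quotient of \<open>Shat S X\<close> is itself an object
  of the comma category, and the component of a point there lies in the image of \<open>E\<close>.
\<close>

section \<open>Semimodules\<close>

lemma semimodule_homI:
  assumes "\<And>x. x \<in> carrier M \<Longrightarrow> h x \<in> carrier N"
    and "\<And>x y. x \<in> carrier M \<Longrightarrow> y \<in> carrier M \<Longrightarrow> h (x \<oplus>\<^bsub>M\<^esub> y) = h x \<oplus>\<^bsub>N\<^esub> h y"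
    and "h \<zero>\<^bsub>M\<^esub> = \<zero>\<^bsub>N\<^esub>"
    and "\<And>s x. s \<in> carrier S \<Longrightarrow> x \<in> carrier M \<Longrightarrow> h (s \<odot>\<^bsub>M\<^esub> x) = s \<odot>\<^bsub>N\<^esub> h x"
  shows "h \<in> semimodule_hom S M N"
  using assms by (auto simp: semimodule_hom_def)

lemma semimodule_homD:
  assumes "h \<in> semimodule_hom S M N"
  shows "x \<in> carrier M \<Longrightarrow> h x \<in> carrier N"
    and "x \<in> carrier M \<Longrightarrow> y \<in> carrier M \<Longrightarrow> h (x \<oplus>\<^bsub>M\<^esub> y) = h x \<oplus>\<^bsub>N\<^esub> h y"
    and "h \<zero>\<^bsub>M\<^esub> = \<zero>\<^bsub>N\<^esub>"
    and "s \<in> carrier S \<Longrightarrow> x \<in> carrier M \<Longrightarrow> h (s \<odot>\<^bsub>M\<^esub> x) = s \<odot>\<^bsub>N\<^esub> h x"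
  using assms by (auto simp: semimodule_hom_def)

lemma semimoduleI:
  assumes "semiring S"
    and "\<And>x y. \<lbrakk>x \<in> carrier M; y \<in> carrier M\<rbrakk> \<Longrightarrow> x \<oplus>\<^bsub>M\<^esub> y \<in> carrier M"
    and "\<zero>\<^bsub>M\<^esub> \<in> carrier M"
    and "\<And>x y z. \<lbrakk>x \<in> carrier M; y \<in> carrier M; z \<in> carrier M\<rbrakk> \<Longrightarrow>
      (x \<oplus>\<^bsub>M\<^esub> y) \<oplus>\<^bsub>M\<^esub> z = x \<oplus>\<^bsub>M\<^esub> (y \<oplus>\<^bsub>M\<^esub> z)"
    and "\<And>x y. \<lbrakk>x \<in> carrier M; y \<in> carrier M\<rbrakk> \<Longrightarrow> x \<oplus>\<^bsub>M\<^esub> y = y \<oplus>\<^bsub>M\<^esub> x"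
    and "\<And>x. x \<in> carrier M \<Longrightarrow> \<zero>\<^bsub>M\<^esub> \<oplus>\<^bsub>M\<^esub> x = x"
    and "\<And>s x. \<lbrakk>s \<in> carrier S; x \<in> carrier M\<rbrakk> \<Longrightarrow> s \<odot>\<^bsub>M\<^esub> x \<in> carrier M"
    and "\<And>s x y. \<lbrakk>s \<in> carrier S; x \<in> carrier M; y \<in> carrier M\<rbrakk> \<Longrightarrow>
      s \<odot>\<^bsub>M\<^esub> (x \<oplus>\<^bsub>M\<^esub> y) = s \<odot>\<^bsub>M\<^esub> x \<oplus>\<^bsub>M\<^esub> s \<odot>\<^bsub>M\<^esub> y"
    and "\<And>s t x. \<lbrakk>s \<in> carrier S; t \<in> carrier S; x \<in> carrier M\<rbrakk> \<Longrightarrow>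
      (s \<oplus>\<^bsub>S\<^esub> t) \<odot>\<^bsub>M\<^esub> x = s \<odot>\<^bsub>M\<^esub> x \<oplus>\<^bsub>M\<^esub> t \<odot>\<^bsub>M\<^esub> x"
    and "\<And>s t x. \<lbrakk>s \<in> carrier S; t \<in> carrier S; x \<in> carrier M\<rbrakk> \<Longrightarrow>
      (s \<otimes>\<^bsub>S\<^esub> t) \<odot>\<^bsub>M\<^esub> x = s \<odot>\<^bsub>M\<^esub> (t \<odot>\<^bsub>M\<^esub> x)"
    and "\<And>x. x \<in> carrier M \<Longrightarrow> \<one>\<^bsub>S\<^esub> \<odot>\<^bsub>M\<^esub> x = x"
    and "\<And>x. x \<in> carrier M \<Longrightarrow> \<zero>\<^bsub>S\<^esub> \<odot>\<^bsub>M\<^esub> x = \<zero>\<^bsub>M\<^esub>"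
    and "\<And>s. s \<in> carrier S \<Longrightarrow> s \<odot>\<^bsub>M\<^esub> \<zero>\<^bsub>M\<^esub> = \<zero>\<^bsub>M\<^esub>"
  shows "semimodule S M"
proof -
  have "abelian_monoid M"
    using assms by (intro abelian_monoidI) auto
  moreover have "semimodule_axioms S M"
    using assms by unfold_locales auto
  ultimately show ?thesis
    using assms(1) by (simp add: semimodule_def)
qed

lemma semimoduleD:
  assumes "semimodule S M"
  shows "semiring S"
    and "\<zero>\<^bsub>M\<^esub> \<in> carrier M"
    and "\<lbrakk>x \<in> carrier M; y \<in> carrier M\<rbrakk> \<Longrightarrow> x \<oplus>\<^bsub>M\<^esub> y \<in> carrier M"
    and "\<lbrakk>s \<in> carrier S; x \<in> carrier M\<rbrakk> \<Longrightarrow> s \<odot>\<^bsub>M\<^esub> x \<in> carrier M"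
proof -
  interpret semimodule S M by fact
  show "semiring S" by (rule S.semiring_axioms)
  show "\<zero>\<^bsub>M\<^esub> \<in> carrier M"
    "\<lbrakk>x \<in> carrier M; y \<in> carrier M\<rbrakk> \<Longrightarrow> x \<oplus>\<^bsub>M\<^esub> y \<in> carrier M"
    "\<lbrakk>s \<in> carrier S; x \<in> carrier M\<rbrakk> \<Longrightarrow> s \<odot>\<^bsub>M\<^esub> x \<in> carrier M"
    by (simp_all add: smult_closed)
qed

text \<open>The axioms are equations, so they may be checked after applying each \<open>h i\<close>,
  where they hold in \<open>Q i\<close>; joint injectivity reflects them back to \<open>N\<close>.
  Closure is not an equation and is assumed separately. The lemma serves subsemimodules, through the
  inclusion, and \<open>Shat S X\<close>, through its coordinates.\<close>

lemma semimodule_jointly_injective: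
  assumes S: "semiring S"
    and closed: "\<zero>\<^bsub>N\<^esub> \<in> carrier N"
      "\<And>x y. \<lbrakk>x \<in> carrier N; y \<in> carrier N\<rbrakk> \<Longrightarrow> x \<oplus>\<^bsub>N\<^esub> y \<in> carrier N"
      "\<And>s x. \<lbrakk>s \<in> carrier S; x \<in> carrier N\<rbrakk> \<Longrightarrow> s \<odot>\<^bsub>N\<^esub> x \<in> carrier N"
    and Q: "\<And>i. i \<in> I \<Longrightarrow> semimodule S (Q i)"
    and h: "\<And>i. i \<in> I \<Longrightarrow> h i \<in> semimodule_hom S N (Q i)"
    and inj: "\<And>x y. \<lbrakk>x \<in> carrier N; y \<in> carrier N; \<And>i. i \<in> I \<Longrightarrow> h i x = h i y\<rbrakk> \<Longrightarrow> x = y"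
  shows "semimodule S N"
proof -
  interpret S: semiring S by (rule S)
  note hom [simp] = h[THEN semimodule_homD(1)] h[THEN semimodule_homD(2)]
    h[THEN semimodule_homD(3)] h[THEN semimodule_homD(4)]
  have ab: "abelian_monoid (Q i)" if "i \<in> I" for i
    using Q[OF that] by (simp add: semimodule_def)
  note [simp] = closed ab[THEN abelian_monoid.a_assoc] ab[THEN abelian_monoid.l_zero]
    Q[THEN semimodule.smult_r_distr] Q[THEN semimodule.smult_l_distr]
    Q[THEN semimodule.smult_assoc] Q[THEN semimodule.smult_one]
    Q[THEN semimodule.smult_l_null] Q[THEN semimodule.smult_r_null]
  show ?thesis
  proof (rule semimoduleI[OF S])
    fix x y assume "x \<in> carrier N" "y \<in> carrier N"
    then show "x \<oplus>\<^bsub>N\<^esub> y = y \<oplus>\<^bsub>N\<^esub> x"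
      by (intro inj) (simp_all add: ab[THEN abelian_monoid.a_comm])
  next
    fix x y z assume "x \<in> carrier N" "y \<in> carrier N" "z \<in> carrier N"
    then show "(x \<oplus>\<^bsub>N\<^esub> y) \<oplus>\<^bsub>N\<^esub> z = x \<oplus>\<^bsub>N\<^esub> (y \<oplus>\<^bsub>N\<^esub> z)"
      by (intro inj) simp_all
  next
    fix x assume "x \<in> carrier N"
    then show "\<zero>\<^bsub>N\<^esub> \<oplus>\<^bsub>N\<^esub> x = x" "\<one>\<^bsub>S\<^esub> \<odot>\<^bsub>N\<^esub> x = x" "\<zero>\<^bsub>S\<^esub> \<odot>\<^bsub>N\<^esub> x = \<zero>\<^bsub>N\<^esub>"
      by (auto intro: inj)
  next
    fix s t x y assume "s \<in> carrier S" "t \<in> carrier S" "x \<in> carrier N" "y \<in> carrier N"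
    then show "s \<odot>\<^bsub>N\<^esub> (x \<oplus>\<^bsub>N\<^esub> y) = s \<odot>\<^bsub>N\<^esub> x \<oplus>\<^bsub>N\<^esub> s \<odot>\<^bsub>N\<^esub> y"
      and "(s \<oplus>\<^bsub>S\<^esub> t) \<odot>\<^bsub>N\<^esub> x = s \<odot>\<^bsub>N\<^esub> x \<oplus>\<^bsub>N\<^esub> t \<odot>\<^bsub>N\<^esub> x"
      and "(s \<otimes>\<^bsub>S\<^esub> t) \<odot>\<^bsub>N\<^esub> x = s \<odot>\<^bsub>N\<^esub> (t \<odot>\<^bsub>N\<^esub> x)"
      by (intro inj; simp)+
  next
    fix s assume "s \<in> carrier S"
    then show "s \<odot>\<^bsub>N\<^esub> \<zero>\<^bsub>N\<^esub> = \<zero>\<^bsub>N\<^esub>"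
      by (intro inj) simp_all
  qed (use closed in auto)
qed

section \<open>Subsemimodules, and quotients by congruences\<close>

definition subsemimodule ::
  "('s, 'e) ring_scheme \<Rightarrow> ('s, 'm, 'f) module_scheme \<Rightarrow> 'm set \<Rightarrow> bool" where
  "subsemimodule S M E \<longleftrightarrow> E \<subseteq> carrier M \<and> \<zero>\<^bsub>M\<^esub> \<in> E \<and>
     (\<forall>x\<in>E. \<forall>y\<in>E. x \<oplus>\<^bsub>M\<^esub> y \<in> E) \<and> (\<forall>s\<in>carrier S. \<forall>x\<in>E. s \<odot>\<^bsub>M\<^esub> x \<in> E)"

lemma semimodule_subsemimodule:
  assumes "semimodule S M" and "subsemimodule S M E"
  shows "semimodule S (M\<lparr>carrier := E\<rparr>)"
\<comment> \<open>One index is enough, since the inclusion into \<open>M\<close> is already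
  injective.\<close>
proof (rule semimodule_jointly_injective[where I = UNIV and Q = "\<lambda>_ :: unit. M" and h = "\<lambda>_ x. x"])
  show "semiring S" using assms(1) by (rule semimoduleD)
  show "(\<lambda>x. x) \<in> semimodule_hom S (M\<lparr>carrier := E\<rparr>) M"
    using assms(2) by (intro semimodule_homI) (auto simp: subsemimodule_def)
qed (use assms in \<open>auto simp: subsemimodule_def\<close>)

text \<open>Needed for uniqueness: the set where two extensions agree becomes the \<open>E\<close>
  of the density argument.\<close>

lemma subsemimodule_equalizer:
  assumes M: "semimodule S M" and h: "h \<in> semimodule_hom S M N" and k: "k \<in> semimodule_hom S M N"
  shows "subsemimodule S M {x \<in> carrier M. h x = k x}"
  using semimoduleD[OF M] semimodule_homD[OF h] semimodule_homD[OF k]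
  by (simp add: subsemimodule_def)

text \<open>
  A map whose kernel is a congruence plays the role of that congruence; its codomain can be chosen
  to be \<open>nat\<close> when there are finitely many classes.
\<close>

definition congruent_map ::
  "('s, 'e) ring_scheme \<Rightarrow> ('s, 'm, 'f) module_scheme \<Rightarrow> ('m \<Rightarrow> 'n) \<Rightarrow> bool" where
  "congruent_map S M c \<longleftrightarrow>
     (\<forall>x\<in>carrier M. \<forall>x'\<in>carrier M. \<forall>y\<in>carrier M. \<forall>y'\<in>carrier M.
        c x = c x' \<longrightarrow> c y = c y' \<longrightarrow> c (x \<oplus>\<^bsub>M\<^esub> y) = c (x' \<oplus>\<^bsub>M\<^esub> y')) \<and>
     (\<forall>s\<in>carrier S. \<forall>x\<in>carrier M. \<forall>x'\<in>carrier M. c x = c x' \<longrightarrow> c (s \<odot>\<^bsub>M\<^esub> x) = c (s \<odot>\<^bsub>M\<^esub> x'))"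

text \<open>The quotient of \<open>M\<close> by the kernel of \<open>c\<close>, with the values of
  \<open>c\<close> as names of the classes. The operations act on representatives chosen by
  \<open>inv_into\<close>; congruence of \<open>c\<close> makes the choice irrelevant.\<close>

definition semimodule_image :: "('s, 'm, 'f) module_scheme \<Rightarrow> ('m \<Rightarrow> 'n) \<Rightarrow> ('s, 'n) module" where
  "semimodule_image M c =
     \<lparr>carrier = c ` carrier M, mult = (\<lambda>a b. undefined), one = undefined, zero = c \<zero>\<^bsub>M\<^esub>,
      add = (\<lambda>a b. c (inv_into (carrier M) c a \<oplus>\<^bsub>M\<^esub> inv_into (carrier M) c b)),
      smult = (\<lambda>s a. c (s \<odot>\<^bsub>M\<^esub> inv_into (carrier M) c a))\<rparr>"

lemma carrier_semimodule_image [simp]: "carrier (semimodule_image M c) = c ` carrier M"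
  by (simp add: semimodule_image_def)

lemma congruent_mapD:
  assumes "congruent_map S M c"
  shows "\<lbrakk>x \<in> carrier M; x' \<in> carrier M; y \<in> carrier M; y' \<in> carrier M; c x = c x'; c y = c y'\<rbrakk> \<Longrightarrow>
      c (x \<oplus>\<^bsub>M\<^esub> y) = c (x' \<oplus>\<^bsub>M\<^esub> y')"
    and "\<lbrakk>s \<in> carrier S; x \<in> carrier M; x' \<in> carrier M; c x = c x'\<rbrakk> \<Longrightarrow>
      c (s \<odot>\<^bsub>M\<^esub> x) = c (s \<odot>\<^bsub>M\<^esub> x')"
  using assms unfolding congruent_map_def by blast+

lemma semimodule_image_hom:
  assumes "congruent_map S M c"
  shows "c \<in> semimodule_hom S M (semimodule_image M c)"
proof (rule semimodule_homI)
  have *: "inv_into (carrier M) c (c x) \<in> carrier M" "c (inv_into (carrier M) c (c x)) = c x"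
    if "x \<in> carrier M" for x
    using that by (simp_all add: inv_into_into f_inv_into_f)
  fix x y assume xy: "x \<in> carrier M" "y \<in> carrier M"
  show "c (x \<oplus>\<^bsub>M\<^esub> y) = c x \<oplus>\<^bsub>semimodule_image M c\<^esub> c y"
    unfolding semimodule_image_def by simp (rule congruent_mapD(1)[OF assms]; simp add: * xy)
  fix s assume s: "s \<in> carrier S"
  show "c (s \<odot>\<^bsub>M\<^esub> x) = s \<odot>\<^bsub>semimodule_image M c\<^esub> c x"
    unfolding semimodule_image_def by simp (rule congruent_mapD(2)[OF assms]; simp add: * xy s)
qed (simp_all add: semimodule_image_def)

lemma semimodule_surjective_image:
  assumes M: "semimodule S M" and c: "c \<in> semimodule_hom S M N" and sur: "carrier N = c ` carrier M"
  shows "semimodule S N"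
proof -
  interpret semimodule S M by (rule M)
  note c = semimodule_homD[OF c]
  \<comment> \<open>Oriented so that operations of \<open>N\<close> move under \<open>c\<close>:
    each axiom for \<open>N\<close> turns into \<open>c\<close> applied to the same axiom in
    \<open>M\<close>.\<close>
  have *: "\<And>x y. x \<in> carrier M \<Longrightarrow> y \<in> carrier M \<Longrightarrow> c x \<oplus>\<^bsub>N\<^esub> c y = c (x \<oplus>\<^bsub>M\<^esub> y)"
    "\<And>s x. s \<in> carrier S \<Longrightarrow> x \<in> carrier M \<Longrightarrow> s \<odot>\<^bsub>N\<^esub> c x = c (s \<odot>\<^bsub>M\<^esub> x)" "\<zero>\<^bsub>N\<^esub> = c \<zero>\<^bsub>M\<^esub>"
    using c by auto
  note [simp] = smult_closed smult_r_distr smult_l_distr smult_assoc smult_one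
    smult_l_null smult_r_null M.a_assoc M.l_zero M.r_zero
  show ?thesis
  proof (rule semimoduleI[OF S.semiring_axioms])
    fix a b assume "a \<in> carrier N" "b \<in> carrier N"
    then show "a \<oplus>\<^bsub>N\<^esub> b = b \<oplus>\<^bsub>N\<^esub> a"
      by (auto simp: sur * M.a_comm)
  qed (auto simp: sur *)
qed

lemma semimodule_image_semimodule:
  assumes "semimodule S M" and "congruent_map S M c"
  shows "semimodule S (semimodule_image M c)"
  using semimodule_surjective_image[OF assms(1) semimodule_image_hom[OF assms(2)]] by simp

text \<open>The universal property of a quotient: a homomorphism whose kernel contains that of the
  surjection \<open>c\<close> descends along \<open>c\<close>. The factor \<open>m\<close> is given
  by a formula so that the same map can be named where the lemma is applied.\<close>

lemma semimodule_hom_factor: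
  assumes c: "c \<in> semimodule_hom S M Q" and sur: "carrier Q = c ` carrier M"
    and M: "semimodule S M" and h: "h \<in> semimodule_hom S M N"
    and ker: "\<And>x y. \<lbrakk>x \<in> carrier M; y \<in> carrier M; c x = c y\<rbrakk> \<Longrightarrow> h x = h y"
  defines "m \<equiv> \<lambda>a. h (inv_into (carrier M) c a)"
  shows "x \<in> carrier M \<Longrightarrow> m (c x) = h x" and "m \<in> semimodule_hom S Q N"
proof -
  have m: "m (c x) = h x" if "x \<in> carrier M" for x
    unfolding m_def using that by (intro ker) (simp_all add: inv_into_into f_inv_into_f)
  then show "x \<in> carrier M \<Longrightarrow> m (c x) = h x" .
  note c = semimodule_homD[OF c] and h = semimodule_homD[OF h] and M = semimoduleD[OF M]
  show "m \<in> semimodule_hom S Q N"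
  proof (rule semimodule_homI)
    show "m \<zero>\<^bsub>Q\<^esub> = \<zero>\<^bsub>N\<^esub>" using m[of "\<zero>\<^bsub>M\<^esub>"] M c h by simp
  next
    fix a b assume "a \<in> carrier Q" "b \<in> carrier Q"
    then obtain x y where "x \<in> carrier M" "y \<in> carrier M" "a = c x" "b = c y"
      unfolding sur by blast
    then show "m (a \<oplus>\<^bsub>Q\<^esub> b) = m a \<oplus>\<^bsub>N\<^esub> m b" using m[of "x \<oplus>\<^bsub>M\<^esub> y"] m[of x] m[of y] M c h by simp
  next
    fix s a assume s: "s \<in> carrier S" and "a \<in> carrier Q"
    then obtain x where "x \<in> carrier M" "a = c x" unfolding sur by blast
    then show "m (s \<odot>\<^bsub>Q\<^esub> a) = s \<odot>\<^bsub>N\<^esub> m a" using m[of "s \<odot>\<^bsub>M\<^esub> x"] m[of x] s M c h by simp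
  next
    fix a assume "a \<in> carrier Q"
    then show "m a \<in> carrier N" unfolding sur using m h(1) by auto
  qed
qed

text \<open>The kernel of the pairing is the intersection of the two kernels. Encoding pairs
  injectively keeps the codomain \<open>nat\<close>, the carrier type of the finite
  semimodules.\<close>

lemma congruent_map_pair:
  assumes "congruent_map S M c" and "congruent_map S M d"
  shows "congruent_map S M (\<lambda>x. prod_encode (c x, d x))"
  unfolding congruent_map_def prod_encode_eq prod.inject
  using congruent_mapD[OF assms(1)] congruent_mapD[OF assms(2)] by blast

lemma congruent_map_hom:
  assumes "h \<in> semimodule_hom S M N"
  shows "congruent_map S M h"
  unfolding congruent_map_def by (simp add: semimodule_homD[OF assms])

lemma congruent_map_subset:
  assumes "subsemimodule S M E" and "congruent_map S M c"
  shows "congruent_map S (M\<lparr>carrier := E\<rparr>) c"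
proof -
  have "E \<subseteq> carrier M" using assms(1) by (simp add: subsemimodule_def)
  then show ?thesis
    unfolding congruent_map_def using congruent_mapD[OF assms(2)]
    by (simp add: subset_iff)
qed

section \<open>Boolean spaces\<close>

text \<open>Each condition \<open>m (t i) = t j\<close> involves two coordinates, and the pair of
  them varies in a discrete space, where every set is closed. The compatible families are the
  intersection of these closed conditions.\<close>

lemma closedin_compatible_families:
  fixes I :: "'i set" and C :: "'i \<Rightarrow> 'c set"
  defines "P \<equiv> product_topology (\<lambda>i. discrete_topology (C i)) I"
  shows "closedin P (topspace P \<inter> {t. \<forall>i\<in>I. \<forall>j\<in>I. \<forall>m. A i j m \<longrightarrow> m (t i) = t j})"
proof -
  \<comment> \<open>Inserting the whole space keeps the intersected family nonempty when the diagram
    has no arrows.\<close>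
  let ?K = "insert (topspace P)
    ((\<lambda>(i, j, m). {t \<in> topspace P. m (t i) = t j}) ` {(i, j, m). i \<in> I \<and> j \<in> I \<and> A i j m})"
  have "closedin P {t \<in> topspace P. m (t i) = t j}" if "i \<in> I" "j \<in> I" for i j m
  proof -
    have "continuous_map P (discrete_topology (C i \<times> C j)) (\<lambda>t. (t i, t j))"
      unfolding prod_topology_discrete_topology P_def
      using that by (intro continuous_map_pairedI continuous_map_product_projection)
    \<comment> \<open>The closed set pulled back is the graph of \<open>m\<close> inside
      \<open>C i \<times> C j\<close>.\<close>
    from closedin_continuous_map_preimage[OF this, of "{ab \<in> C i \<times> C j. m (fst ab) = snd ab}"]
    have "closedin P {t \<in> topspace P. (t i, t j) \<in> {ab \<in> C i \<times> C j. m (fst ab) = snd ab}}"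
      by auto
    also have "{t \<in> topspace P. (t i, t j) \<in> {ab \<in> C i \<times> C j. m (fst ab) = snd ab}} =
        {t \<in> topspace P. m (t i) = t j}"
      using that by (auto simp: P_def PiE_iff)
    finally show ?thesis .
  qed
  then have "closedin P (\<Inter>?K)"
    by (intro closedin_Inter) auto
  also have "\<Inter>?K = topspace P \<inter> {t. \<forall>i\<in>I. \<forall>j\<in>I. \<forall>m. A i j m \<longrightarrow> m (t i) = t j}"
    by auto
  finally show ?thesis .
qed

text \<open>The limit is a closed subspace of a product of finite discrete spaces, hence compact by
  Tychonoff and Hausdorff. Boxes traced on it give the clopen basis.\<close>

lemma boolean_space_limit:
  assumes fin: "\<And>i. i \<in> I \<Longrightarrow> finite (C i)"
  shows "boolean_space (limit_space I (\<lambda>i. discrete_topology (C i)) A)"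
proof -
  let ?P = "product_topology (\<lambda>i. discrete_topology (C i)) I"
  let ?K = "{t. \<forall>i\<in>I. \<forall>j\<in>I. \<forall>m. A i j m \<longrightarrow> m (t i) = t j}"
  let ?L = "limit_space I (\<lambda>i. discrete_topology (C i)) A"
  have L: "?L = subtopology ?P (topspace ?P \<inter> ?K)"
    unfolding limit_space_def by (rule subtopology_restrict[symmetric])
  have "compact_space ?P"
    using fin by (auto simp: compact_space_product_topology compact_space_discrete_topology)
  then have "compact_space ?L"
    unfolding L by (intro compact_space_subtopology closedin_compact_space closedin_compatible_families)
  moreover have "Hausdorff_space ?L"
    unfolding L by (intro Hausdorff_space_subtopology) (simp add: Hausdorff_space_product_topology)
  moreover have "openin ?L = arbitrary union_of (\<lambda>U. U \<in> {U. openin ?L U \<and> closedin ?L U})"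
    unfolding openin_topology_base_unique
  proof (intro conjI allI impI)
    fix U x assume "openin ?L U \<and> x \<in> U"
    then obtain W where W: "openin ?P W" "U = W \<inter> ?K" and x: "x \<in> W" "x \<in> ?K"
      unfolding limit_space_def openin_subtopology by blast
    then obtain V where V: "finite {i \<in> I. V i \<noteq> topspace (discrete_topology (C i))}"
        "\<forall>i\<in>I. openin (discrete_topology (C i)) (V i)" "x \<in> Pi\<^sub>E I V" "Pi\<^sub>E I V \<subseteq> W"
      unfolding openin_product_topology_alt by meson
    \<comment> \<open>The box is open because only finitely many factors are proper, and closed
      because every factor is closed in its discrete space.\<close>
    have "openin ?P (Pi\<^sub>E I V)" and "closedin ?P (Pi\<^sub>E I V)"
      using V by (auto simp: openin_PiE_gen closedin_product_topology)
    then have "openin ?L (Pi\<^sub>E I V \<inter> ?K)" and "closedin ?L (Pi\<^sub>E I V \<inter> ?K)"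
      unfolding limit_space_def openin_subtopology closedin_subtopology by blast+
    moreover have "x \<in> Pi\<^sub>E I V \<inter> ?K" using V(3) x(2) by (rule IntI)
    moreover have "Pi\<^sub>E I V \<inter> ?K \<subseteq> U" unfolding W(2) using V(4) by (rule Int_mono) simp
    ultimately show "\<exists>V. V \<in> {U. openin ?L U \<and> closedin ?L U} \<and> x \<in> V \<and> V \<subseteq> U"
      by (intro exI[of _ "Pi\<^sub>E I V \<inter> ?K"]) simp
  qed auto
  ultimately show ?thesis
    unfolding boolean_space_def
    by (intro conjI exI[of _ "{U. openin ?L U \<and> closedin ?L U}"]) auto
qed

text \<open>Quotient maps are taken continuous into all of \<open>nat\<close>, so that their images
  need not be carried along. This lemma and the next pass to a particular carrier and back.\<close>

lemma continuous_map_discrete_image: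
  assumes "continuous_map T (discrete_topology UNIV) c" and "c ` topspace T \<subseteq> A"
  shows "continuous_map T (discrete_topology A) c"
  using continuous_map_into_subtopology[OF assms(1), of A] assms(2) by auto

lemma continuous_map_discrete_UNIV:
  assumes "continuous_map T (discrete_topology A) c"
  shows "continuous_map T (discrete_topology UNIV) c"
proof -
  have "discrete_topology A = subtopology (discrete_topology UNIV) A" by simp
  with assms show ?thesis by (metis continuous_map_in_subtopology)
qed

section \<open>Finite quotients and profinite semimodules\<close>

text \<open>Encodes a congruence with finitely many classes, all clopen, as the kernel of a map to
  \<open>nat\<close>.\<close>

definition finite_quotient_map ::
  "('s, 'e) ring_scheme \<Rightarrow> ('s, 'm, 'f) module_scheme \<Rightarrow> 'm topology \<Rightarrow> ('m \<Rightarrow> nat) \<Rightarrow> bool" where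
  "finite_quotient_map S M T c \<longleftrightarrow> finite (c ` carrier M) \<and>
     continuous_map T (discrete_topology UNIV) c \<and> congruent_map S M c"

lemma finite_quotient_map_hom:
  assumes "h \<in> semimodule_hom S M N" and "finite (carrier N)"
    and "continuous_map T (discrete_space N) h"
  shows "finite_quotient_map S M T h"
  unfolding finite_quotient_map_def
proof (intro conjI)
  have "h ` carrier M \<subseteq> carrier N" using assms(1) by (auto simp: semimodule_hom_def)
  then show "finite (h ` carrier M)" using assms(2) finite_subset by blast
qed (use assms in \<open>auto intro: congruent_map_hom continuous_map_discrete_UNIV\<close>)

lemma finite_quotient_map_pair:
  assumes c: "finite_quotient_map S M T c" and d: "finite_quotient_map S M T d"
  shows "finite_quotient_map S M T (\<lambda>x. prod_encode (c x, d x))"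
  unfolding finite_quotient_map_def
proof (intro conjI)
  have "(\<lambda>x. prod_encode (c x, d x)) ` carrier M \<subseteq> prod_encode ` (c ` carrier M \<times> d ` carrier M)"
    by blast
  moreover have "finite (prod_encode ` (c ` carrier M \<times> d ` carrier M))"
    using c d by (simp add: finite_quotient_map_def)
  ultimately show "finite ((\<lambda>x. prod_encode (c x, d x)) ` carrier M)"
    by (rule finite_subset)
  have "continuous_map T (discrete_topology (UNIV \<times> UNIV)) (\<lambda>x. (c x, d x))"
    unfolding prod_topology_discrete_topology
    using c d by (intro continuous_map_pairedI) (auto simp: finite_quotient_map_def)
  then have "continuous_map T (discrete_topology UNIV) (prod_encode \<circ> (\<lambda>x. (c x, d x)))"
    by (rule continuous_map_compose) simp
  then show "continuous_map T (discrete_topology UNIV) (\<lambda>x. prod_encode (c x, d x))"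
    by (simp add: o_def)
qed (use c d in \<open>auto simp: finite_quotient_map_def intro: congruent_map_pair\<close>)

text \<open>Codirectedness of the finite quotients, by iterated pairing.\<close>

lemma finite_quotient_map_common_refinement:
  assumes "finite F" and "\<And>c. c \<in> F \<Longrightarrow> finite_quotient_map S M T c"
  shows "\<exists>d. finite_quotient_map S M T d \<and> (\<forall>c\<in>F. \<forall>x y. d x = d y \<longrightarrow> c x = c y)"
  using assms
proof (induction F)
  case empty
  \<comment> \<open>The constant map, with at most one class, serves the empty family.\<close>
  have "finite_quotient_map S M T (\<lambda>_. 0)"
    by (auto simp: finite_quotient_map_def congruent_map_def)
      (metis finite.emptyI finite_insert finite_subset image_subsetI insertI1)
  then show ?case by blast
next
  case (insert c F)
  then obtain d where d: "finite_quotient_map S M T d" "\<forall>c\<in>F. \<forall>x y. d x = d y \<longrightarrow> c x = c y"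
    by auto
  have "finite_quotient_map S M T (\<lambda>x. prod_encode (c x, d x))"
    using insert.prems d(1) by (intro finite_quotient_map_pair) auto
  moreover have "\<forall>c'\<in>insert c F. \<forall>x y. prod_encode (c x, d x) = prod_encode (c y, d y) \<longrightarrow> c' x = c' y"
    using d(2) by (simp add: prod_encode_eq)
  ultimately show ?case by (intro exI[of _ "\<lambda>x. prod_encode (c x, d x)"]) simp
qed

lemma finite_quotient_map_image:
  assumes "semimodule S M" and "finite_quotient_map S M T c"
  shows "semimodule_image M c \<in> finite_semimodules S" and "c \<in> semimodule_hom S M (semimodule_image M c)"
  using assms semimodule_image_semimodule semimodule_image_hom
  by (auto simp: finite_semimodules_def finite_quotient_map_def)

text \<open>The comparison map to the limit of all finite quotients is injective by separation and
  surjective by compactness. A continuous bijection from a compact space to a Hausdorff space is a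
  homeomorphism.\<close>

lemma profinite_semimoduleI:
  fixes M :: "('s, 'm, 'f) module_scheme"
  assumes M: "semimodule S M" and T: "boolean_space T" and TM: "topspace T = carrier M"
    and sep: "\<And>x y. \<lbrakk>x \<in> carrier M; y \<in> carrier M; x \<noteq> y\<rbrakk> \<Longrightarrow>
      \<exists>c. finite_quotient_map S M T c \<and> c x \<noteq> c y"
  shows "profinite_semimodule TYPE(('m \<times> 'm) set) S M T"
proof -
  \<comment> \<open>The diagram is indexed by kernels, since inclusion of kernels is antisymmetric
    while different maps can share a kernel. \<open>p i\<close> chooses a map with kernel
    \<open>i\<close>, and a smaller kernel is a finer quotient, so \<open>tr i j\<close>
    coarsens.\<close>
  define ker :: "('m \<Rightarrow> nat) \<Rightarrow> ('m \<times> 'm) set"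
    where "ker c = {(x, y). x \<in> carrier M \<and> y \<in> carrier M \<and> c x = c y}" for c
  define J where "J = ker ` Collect (finite_quotient_map S M T)"
  define p where "p i = (SOME c. finite_quotient_map S M T c \<and> ker c = i)" for i
  define Y where "Y i = semimodule_image M (p i)" for i
  define r where "r = {(i, j). i \<in> J \<and> j \<in> J \<and> i \<subseteq> j}"
  define tr where "tr i j a = p j (inv_into (carrier M) (p i) a)" for i j a
  have p: "finite_quotient_map S M T (p i)" "ker (p i) = i" if "i \<in> J" for i
    using someI_ex[of "\<lambda>c. finite_quotient_map S M T c \<and> ker c = i"] that
    unfolding J_def p_def by blast+
  have kerI: "ker c \<in> J" if "finite_quotient_map S M T c" for c
    using that by (simp add: J_def)
  have Y: "Y i \<in> finite_semimodules S" "p i \<in> semimodule_hom S M (Y i)"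
    "carrier (Y i) = p i ` carrier M" if "i \<in> J" for i
    using finite_quotient_map_image[OF M p(1)[OF that]] by (simp_all add: Y_def)
  have le: "p j x = p j y" if "(i, j) \<in> r" "x \<in> carrier M" "y \<in> carrier M" "p i x = p i y" for i j x y
    using that p unfolding r_def ker_def by blast
  have trh: "tr i j \<in> semimodule_hom S (Y i) (Y j)"
    and tr: "\<And>x. x \<in> carrier M \<Longrightarrow> tr i j (p i x) = p j x" if ij: "(i, j) \<in> r" for i j
  proof -
    have "i \<in> J" "j \<in> J" using ij by (simp_all add: r_def)
    note factor = semimodule_hom_factor[OF Y(2,3)[OF this(1)] M Y(2)[OF this(2)] le[OF ij]]
    show "tr i j (p i x) = p j x" if "x \<in> carrier M" for x
      unfolding tr_def using factor(1) that by blast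
    show "tr i j \<in> semimodule_hom S (Y i) (Y j)"
      unfolding tr_def[abs_def] using factor(2) by blast
  qed
  \<comment> \<open>Lower bounds of arbitrary finite families: the empty one yields
    \<open>J \<noteq> {}\<close>, pairs yield codirectedness, and the general case drives the
    compactness argument.\<close>
  have lower: "\<exists>k\<in>J. \<forall>i\<in>F. (k, i) \<in> r" if "finite F" "F \<subseteq> J" for F
  proof -
    have "finite_quotient_map S M T c" if "c \<in> p ` F" for c
      using that p(1) \<open>F \<subseteq> J\<close> by blast
    then obtain d where d: "finite_quotient_map S M T d"
        "\<forall>c\<in>p ` F. \<forall>x y. d x = d y \<longrightarrow> c x = c y"
      using finite_quotient_map_common_refinement finite_imageI[OF \<open>finite F\<close>] by metis
    have "ker d \<subseteq> ker (p i)" if "i \<in> F" for i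
      unfolding ker_def using d(2) that by blast
    then show ?thesis
      using kerI[OF d(1)] p(2) \<open>F \<subseteq> J\<close> by (intro bexI[of _ "ker d"]) (auto simp: r_def)
  qed
  have cod: "codirected_diagram S J r Y tr"
    unfolding codirected_diagram_def
  proof (intro conjI)
    show "partial_order_on J r"
      unfolding partial_order_on_def preorder_on_def r_def
      by (auto simp: refl_on_def trans_def antisym_def)
    show "J \<noteq> {}" using lower[of "{}"] by auto
    show "\<forall>i\<in>J. \<forall>j\<in>J. \<exists>k\<in>J. (k, i) \<in> r \<and> (k, j) \<in> r"
    proof (intro ballI)
      fix i j assume "i \<in> J" "j \<in> J"
      then show "\<exists>k\<in>J. (k, i) \<in> r \<and> (k, j) \<in> r" using lower[of "{i, j}"] by simp
    qed
    show "\<forall>i\<in>J. \<forall>y\<in>carrier (Y i). tr i i y = y"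
      using tr Y(3) by (auto simp: r_def)
    show "\<forall>i j k. (i, j) \<in> r \<longrightarrow> (j, k) \<in> r \<longrightarrow> (\<forall>y\<in>carrier (Y i). tr j k (tr i j y) = tr i k y)"
    proof (intro allI impI ballI)
      fix i j k y assume ij: "(i, j) \<in> r" and jk: "(j, k) \<in> r" and "y \<in> carrier (Y i)"
      moreover have "(i, k) \<in> r" using ij jk by (auto simp: r_def)
      moreover from calculation obtain x where "x \<in> carrier M" "y = p i x"
        using Y(3)[of i] by (auto simp: r_def)
      ultimately show "tr j k (tr i j y) = tr i k y" by (simp add: tr)
    qed
  qed (use Y trh in auto)
  let ?D = "\<lambda>i. discrete_space (Y i)" and ?A = "\<lambda>i j m. (i, j) \<in> r \<and> m = tr i j"
  have cont: "continuous_map T (?D i) (p i)" if "i \<in> J" for i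
    by (rule continuous_map_discrete_image)
      (use p(1)[OF that] Y(3)[OF that] TM in \<open>simp_all add: finite_quotient_map_def\<close>)
  have cone: "cone J ?D ?A T p"
    unfolding cone_def using cont tr TM by auto
  \<comment> \<open>A point realising \<open>t\<close> is a common point of the fibres
    \<open>K i\<close>. These are closed, so by compactness finitely many of them may be considered;
    a preimage of \<open>t k\<close>, with \<open>k\<close> below all their indices, lies in
    each.\<close>
  have sur: "\<exists>x\<in>carrier M. \<forall>i\<in>J. p i x = t i" if t: "t \<in> topspace (limit_space J ?D ?A)" for t
  proof -
    define K where "K i = {x \<in> topspace T. p i x \<in> {t i}}" for i
    have tY: "t i \<in> carrier (Y i)" if "i \<in> J" for i
      using t that unfolding topspace_limit_space by auto
    have tt: "tr i j (t i) = t j" if "(i, j) \<in> r" for i j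
      using t that unfolding topspace_limit_space r_def by blast
    have "\<Inter>(K ` J) \<noteq> {}"
    proof (rule compact_space_fip[THEN iffD1, rule_format])
      show "compact_space T" using T by (simp add: boolean_space_def)
      have "closedin T (K i)" if "i \<in> J" for i
        unfolding K_def using that tY
        by (intro closedin_continuous_map_preimage[OF cont]) auto
      moreover have "\<Inter>\<F> \<noteq> {}" if \<F>: "finite \<F>" "\<F> \<subseteq> K ` J" for \<F>
      proof -
        obtain F where F: "finite F" "F \<subseteq> J" "\<F> = K ` F"
          using finite_subset_image[OF \<F>] by blast
        from lower[OF F(1,2)] obtain k where k: "k \<in> J" "\<forall>i\<in>F. (k, i) \<in> r" by blast
        obtain x where x: "x \<in> carrier M" "t k = p k x"
          using tY[OF k(1)] Y(3)[OF k(1)] by auto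
        have "x \<in> K i" if "i \<in> F" for i
        proof -
          have "p i x = tr k i (p k x)" using tr k that x by simp
          also have "\<dots> = t i" using tt[of k i] k that x by simp
          finally show ?thesis using x TM by (simp add: K_def)
        qed
        then show ?thesis using F by blast
      qed
      ultimately show "(\<forall>C\<in>K ` J. closedin T C) \<and> (\<forall>\<F>. finite \<F> \<and> \<F> \<subseteq> K ` J \<longrightarrow> \<Inter>\<F> \<noteq> {})"
        by blast
    qed
    then obtain x where "\<forall>i\<in>J. x \<in> K i" by blast
    \<comment> \<open>Nonemptiness of \<open>J\<close>, contained in \<open>cod\<close>, is what
      puts \<open>x\<close> in \<open>carrier M\<close>.\<close>
    with cod TM show ?thesis by (auto simp: K_def codirected_diagram_def)
  qed
  have "homeomorphic_map T (limit_space J ?D ?A) (\<lambda>z. \<lambda>i\<in>J. p i z)"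
  proof (rule continuous_imp_homeomorphic_map)
    show "compact_space T" using T by (simp add: boolean_space_def)
    show "Hausdorff_space (limit_space J ?D ?A)"
      using boolean_space_limit[of J "\<lambda>i. carrier (Y i)" ?A] Y(1)
      by (simp add: boolean_space_def finite_semimodules_def)
    show c: "continuous_map T (limit_space J ?D ?A) (\<lambda>z. \<lambda>i\<in>J. p i z)"
      by (rule cone_tuple_continuous[OF cone])
    show "(\<lambda>z. \<lambda>i\<in>J. p i z) ` topspace T = topspace (limit_space J ?D ?A)"
    proof
      show "(\<lambda>z. \<lambda>i\<in>J. p i z) ` topspace T \<subseteq> topspace (limit_space J ?D ?A)"
        using c continuous_map_image_subset_topspace by blast
      show "topspace (limit_space J ?D ?A) \<subseteq> (\<lambda>z. \<lambda>i\<in>J. p i z) ` topspace T"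
      proof
        fix t assume t: "t \<in> topspace (limit_space J ?D ?A)"
        then obtain x where x: "x \<in> carrier M" "\<forall>i\<in>J. p i x = t i" using sur by blast
        have "t = (\<lambda>i\<in>J. p i x)"
          using t x unfolding topspace_limit_space by (auto simp: PiE_iff extensional_def)
        then show "t \<in> (\<lambda>z. \<lambda>i\<in>J. p i z) ` topspace T" using x TM by auto
      qed
    qed
    show "inj_on (\<lambda>z. \<lambda>i\<in>J. p i z) (topspace T)"
    proof (rule inj_onI, rule ccontr)
      fix x y assume xy: "x \<in> topspace T" "y \<in> topspace T" "(\<lambda>i\<in>J. p i x) = (\<lambda>i\<in>J. p i y)" "x \<noteq> y"
      then obtain c where c: "finite_quotient_map S M T c" "c x \<noteq> c y" using sep TM by blast
      \<comment> \<open>The separating map \<open>c\<close> need not itself be one of the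
        \<open>p i\<close>, but the chosen map with the same kernel separates the same
        points.\<close>
      have "p (ker c) x = p (ker c) y"
        using fun_cong[OF xy(3), of "ker c"] kerI[OF c(1)] by simp
      then have "(x, y) \<in> ker c"
        using p(2)[OF kerI[OF c(1)]] xy TM unfolding ker_def by blast
      then show False using c(2) by (simp add: ker_def)
    qed
  qed
  then show ?thesis
    unfolding profinite_semimodule_def limit_cone_def
    using M T TM cod Y(2) cone by blast
qed

section \<open>The semimodule structure of \<open>Shat S X\<close>\<close>

text \<open>Terms with coefficient zero vanish. Hence a sum such as \<open>1t + 1u\<close> can be
  computed over \<open>{t, u}\<close> without deciding whether its coefficients are zero in
  \<open>S\<close>.\<close>

lemma formal_eval_superset:
  assumes Y: "semimodule S Y" and \<phi>: "\<phi> \<in> A \<rightarrow> carrier Y" and f: "f \<in> formal_sums S A"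
    and F: "finite F" "F \<subseteq> A" "\<And>x. x \<in> A - F \<Longrightarrow> f x = \<zero>\<^bsub>S\<^esub>"
  shows "formal_eval S Y A \<phi> f = (\<Oplus>\<^bsub>Y\<^esub>x\<in>F. f x \<odot>\<^bsub>Y\<^esub> \<phi> x)"
proof -
  interpret Y: semimodule S Y by (rule Y)
  show ?thesis
    unfolding formal_eval_def
  proof (rule Y.add.finprod_mono_neutral_cong_left)
    show "(\<lambda>x. f x \<odot>\<^bsub>Y\<^esub> \<phi> x) \<in> F \<rightarrow> carrier Y"
      using \<phi> f F(2) by (auto simp: formal_sums_def intro!: Y.smult_closed)
    show "f x \<odot>\<^bsub>Y\<^esub> \<phi> x = \<zero>\<^bsub>Y\<^esub>" if "x \<in> F - {x \<in> A. f x \<noteq> \<zero>\<^bsub>S\<^esub>}" for x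
      using that F(2) \<phi> by (auto intro!: Y.smult_l_null)
  qed (use F in auto)
qed

section \<open>Coordinates of points of \<open>Shat S X\<close>\<close>

lemma comma_objectsD:
  assumes "(\<phi>, Y) \<in> comma_objects S X"
  shows "semimodule S Y" and "finite (carrier Y)" and "x \<in> topspace X \<Longrightarrow> \<phi> x \<in> carrier Y"
    and "continuous_map X (discrete_space Y) \<phi>"
  using assms continuous_map_image_subset_topspace[of X "discrete_space Y" \<phi>]
  by (auto simp: comma_objects_def finite_semimodules_def)

lemma Shat_coord_closed:
  assumes "t \<in> topspace (Shat S X)" and "(\<phi>, Y) \<in> comma_objects S X"
  shows "t (\<phi>, Y) \<in> carrier Y"
  using assms unfolding topspace_Shat by blast

lemma Shat_unit_closed:
  assumes "x \<in> topspace X"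
  shows "Shat_unit S X x \<in> topspace (Shat S X)"
  using continuous_map_image_subset_topspace[OF Shat_unit_continuous[of X S]] assms by auto

lemma Shat_eqI:
  assumes "t \<in> topspace (Shat S X)" and "u \<in> topspace (Shat S X)"
    and "\<And>\<phi> Y. (\<phi>, Y) \<in> comma_objects S X \<Longrightarrow> t (\<phi>, Y) = u (\<phi>, Y)"
  shows "t = u"
proof (rule extensionalityI)
  show "t \<in> extensional (comma_objects S X)" "u \<in> extensional (comma_objects S X)"
    using assms(1,2) unfolding topspace_Shat by blast+
qed (use assms(3) in auto)

text \<open>Multiplication reads the component at the projection
  \<open>Shat_proj S X (\<phi>, Y)\<close>, regarded as a comma object over \<open>Shat S X\<close>;
  there \<open>Shat_tau\<close> is evaluation in \<open>Y\<close>.\<close>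

lemma Shat_mult_tau_coord:
  assumes f: "f \<in> formal_sums S (topspace (Shat S X))" and \<phi>: "(\<phi>, Y) \<in> comma_objects S X"
  shows "Shat_mult S X (Shat_tau S (Shat S X) f) (\<phi>, Y) =
    formal_eval S Y (topspace (Shat S X)) (Shat_proj S X (\<phi>, Y)) f"
  using Shat_tau_closed[OF f] Shat_proj_comma_object[OF \<phi>] f \<phi>
  by (simp add: Shat_mult_def Shat_proj_def[of S "Shat S X"] Shat_tau_def)

lemma Shat_mult_tau_closed:
  assumes "f \<in> formal_sums S (topspace (Shat S X))"
  shows "Shat_mult S X (Shat_tau S (Shat S X) f) \<in> topspace (Shat S X)"
  by (rule Shat_mult_closed[OF Shat_tau_closed[OF assms]])

text \<open>The form used for the operations: the sum runs over any finite set containing the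
  support, and projections become plain evaluation of points.\<close>

lemma Shat_mult_tau_coord_sum:
  assumes f: "f \<in> formal_sums S (topspace (Shat S X))" and \<phi>: "(\<phi>, Y) \<in> comma_objects S X"
    and F: "finite F" "F \<subseteq> topspace (Shat S X)" "\<And>x. x \<in> topspace (Shat S X) - F \<Longrightarrow> f x = \<zero>\<^bsub>S\<^esub>"
  shows "Shat_mult S X (Shat_tau S (Shat S X) f) (\<phi>, Y) = (\<Oplus>\<^bsub>Y\<^esub>t\<in>F. f t \<odot>\<^bsub>Y\<^esub> t (\<phi>, Y))"
proof -
  interpret Y: semimodule S Y using \<phi> by (rule comma_objectsD)
  have "Shat_mult S X (Shat_tau S (Shat S X) f) (\<phi>, Y) =
      (\<Oplus>\<^bsub>Y\<^esub>t\<in>F. f t \<odot>\<^bsub>Y\<^esub> Shat_proj S X (\<phi>, Y) t)"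
    unfolding Shat_mult_tau_coord[OF f \<phi>] using Shat_coord_closed[OF _ \<phi>] f F
    by (intro formal_eval_superset[OF comma_objectsD(1)[OF \<phi>]]) (auto simp: Shat_proj_def)
  also have "\<dots> = (\<Oplus>\<^bsub>Y\<^esub>t\<in>F. f t \<odot>\<^bsub>Y\<^esub> t (\<phi>, Y))"
    using F(2) f Shat_coord_closed[OF _ \<phi>]
    by (intro Y.finsum_cong') (auto simp: Shat_proj_def formal_sums_def intro!: Y.smult_closed)
  finally show ?thesis .
qed

section \<open>The canonical operations in coordinates\<close>

lemma carrier_Shat_semimodule [simp]: "carrier (Shat_semimodule S X) = topspace (Shat S X)"
  by (simp add: Shat_semimodule_def algebra_semimodule_def)

lemma formal_sums_restrict:
  assumes "\<And>z. z \<in> A \<Longrightarrow> f z \<in> carrier S" and "finite F" "\<And>z. z \<in> A - F \<Longrightarrow> f z = \<zero>\<^bsub>S\<^esub>"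
  shows "(\<lambda>z\<in>A. f z) \<in> formal_sums S A"
proof -
  have "{x \<in> A. (\<lambda>z\<in>A. f z) x \<noteq> \<zero>\<^bsub>S\<^esub>} \<subseteq> F" using assms(3) by auto
  then have "finite {x \<in> A. (\<lambda>z\<in>A. f z) x \<noteq> \<zero>\<^bsub>S\<^esub>}" using assms(2) finite_subset by blast
  then show ?thesis
    using assms(1) by (simp add: formal_sums_def)
qed

context
  fixes S :: "('s, 'e) ring_scheme" and X :: "'x topology"
  assumes S: "semiring S"
begin

interpretation S: semiring S by (rule S)

lemma Shat_zero:
  shows "\<zero>\<^bsub>Shat_semimodule S X\<^esub> \<in> topspace (Shat S X)"
    and "(\<phi>, Y) \<in> comma_objects S X \<Longrightarrow> \<zero>\<^bsub>Shat_semimodule S X\<^esub> (\<phi>, Y) = \<zero>\<^bsub>Y\<^esub>"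
proof -
  let ?f = "\<lambda>z\<in>topspace (Shat S X). \<zero>\<^bsub>S\<^esub>"
  have f: "?f \<in> formal_sums S (topspace (Shat S X))"
    by (rule formal_sums_restrict[of _ _ _ "{}"]) auto
  have eq: "\<zero>\<^bsub>Shat_semimodule S X\<^esub> = Shat_mult S X (Shat_tau S (Shat S X) ?f)"
    by (simp add: Shat_semimodule_def algebra_semimodule_def)
  show "\<zero>\<^bsub>Shat_semimodule S X\<^esub> \<in> topspace (Shat S X)"
    unfolding eq by (rule Shat_mult_tau_closed[OF f])
  assume \<phi>: "(\<phi>, Y) \<in> comma_objects S X"
  interpret Y: semimodule S Y using \<phi> by (rule comma_objectsD)
  show "\<zero>\<^bsub>Shat_semimodule S X\<^esub> (\<phi>, Y) = \<zero>\<^bsub>Y\<^esub>"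
    unfolding eq using Shat_mult_tau_coord_sum[OF f \<phi>, of "{}"] by simp
qed

lemma Shat_add:
  assumes t: "t \<in> topspace (Shat S X)" and u: "u \<in> topspace (Shat S X)"
  shows "t \<oplus>\<^bsub>Shat_semimodule S X\<^esub> u \<in> topspace (Shat S X)"
    and "(\<phi>, Y) \<in> comma_objects S X \<Longrightarrow>
      (t \<oplus>\<^bsub>Shat_semimodule S X\<^esub> u) (\<phi>, Y) = t (\<phi>, Y) \<oplus>\<^bsub>Y\<^esub> u (\<phi>, Y)"
proof -
  let ?A = "topspace (Shat S X)"
  let ?f = "\<lambda>z\<in>?A. formal_unit S ?A t z \<oplus>\<^bsub>S\<^esub> formal_unit S ?A u z"
  have f: "?f \<in> formal_sums S ?A"
    by (rule formal_sums_restrict[of _ _ _ "{t, u}"]) (auto simp: formal_unit_def)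
  have eq: "t \<oplus>\<^bsub>Shat_semimodule S X\<^esub> u = Shat_mult S X (Shat_tau S (Shat S X) ?f)"
    by (simp add: Shat_semimodule_def algebra_semimodule_def)
  show "t \<oplus>\<^bsub>Shat_semimodule S X\<^esub> u \<in> ?A"
    unfolding eq by (rule Shat_mult_tau_closed[OF f])
  assume \<phi>: "(\<phi>, Y) \<in> comma_objects S X"
  interpret Y: semimodule S Y using \<phi> by (rule comma_objectsD)
  have c: "t (\<phi>, Y) \<in> carrier Y" "u (\<phi>, Y) \<in> carrier Y"
    using t u \<phi> by (auto intro: Shat_coord_closed)
  have "(t \<oplus>\<^bsub>Shat_semimodule S X\<^esub> u) (\<phi>, Y) = (\<Oplus>\<^bsub>Y\<^esub>z\<in>{t, u}. ?f z \<odot>\<^bsub>Y\<^esub> z (\<phi>, Y))"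
    unfolding eq using t u by (intro Shat_mult_tau_coord_sum[OF f \<phi>]) (auto simp: formal_unit_def)
  also have "\<dots> = t (\<phi>, Y) \<oplus>\<^bsub>Y\<^esub> u (\<phi>, Y)"
  \<comment> \<open>If \<open>t = u\<close>, the set \<open>{t, u}\<close> contributes a single term
    with coefficient \<open>1 + 1\<close>, which is split by distributivity.\<close>
  proof (cases "t = u")
    case True
    then show ?thesis
      using t c by (simp add: formal_unit_def Y.smult_closed Y.smult_l_distr Y.smult_one)
  next
    case False
    then show ?thesis
      using t u c by (auto simp: formal_unit_def Y.smult_closed Y.smult_one)
  qed
  finally show "(t \<oplus>\<^bsub>Shat_semimodule S X\<^esub> u) (\<phi>, Y) = t (\<phi>, Y) \<oplus>\<^bsub>Y\<^esub> u (\<phi>, Y)" .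
qed

lemma Shat_smult:
  assumes s: "s \<in> carrier S" and t: "t \<in> topspace (Shat S X)"
  shows "s \<odot>\<^bsub>Shat_semimodule S X\<^esub> t \<in> topspace (Shat S X)"
    and "(\<phi>, Y) \<in> comma_objects S X \<Longrightarrow>
      (s \<odot>\<^bsub>Shat_semimodule S X\<^esub> t) (\<phi>, Y) = s \<odot>\<^bsub>Y\<^esub> t (\<phi>, Y)"
proof -
  let ?A = "topspace (Shat S X)"
  let ?f = "\<lambda>z\<in>?A. s \<otimes>\<^bsub>S\<^esub> formal_unit S ?A t z"
  have f: "?f \<in> formal_sums S ?A"
    using s by (intro formal_sums_restrict[of _ _ _ "{t}"]) (auto simp: formal_unit_def)
  have eq: "s \<odot>\<^bsub>Shat_semimodule S X\<^esub> t = Shat_mult S X (Shat_tau S (Shat S X) ?f)"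
    by (simp add: Shat_semimodule_def algebra_semimodule_def)
  show "s \<odot>\<^bsub>Shat_semimodule S X\<^esub> t \<in> ?A"
    unfolding eq by (rule Shat_mult_tau_closed[OF f])
  assume \<phi>: "(\<phi>, Y) \<in> comma_objects S X"
  interpret Y: semimodule S Y using \<phi> by (rule comma_objectsD)
  have c: "t (\<phi>, Y) \<in> carrier Y"
    using t \<phi> by (rule Shat_coord_closed)
  have "(s \<odot>\<^bsub>Shat_semimodule S X\<^esub> t) (\<phi>, Y) = (\<Oplus>\<^bsub>Y\<^esub>z\<in>{t}. ?f z \<odot>\<^bsub>Y\<^esub> z (\<phi>, Y))"
    unfolding eq using t s by (intro Shat_mult_tau_coord_sum[OF f \<phi>]) (auto simp: formal_unit_def)
  also have "\<dots> = s \<odot>\<^bsub>Y\<^esub> t (\<phi>, Y)"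
    using s t c by (simp add: formal_unit_def Y.smult_closed)
  finally show "(s \<odot>\<^bsub>Shat_semimodule S X\<^esub> t) (\<phi>, Y) = s \<odot>\<^bsub>Y\<^esub> t (\<phi>, Y)" .
qed

lemma Shat_coord_hom:
  assumes "(\<phi>, Y) \<in> comma_objects S X"
  shows "(\<lambda>t. t (\<phi>, Y)) \<in> semimodule_hom S (Shat_semimodule S X) Y"
  using assms by (intro semimodule_homI) (simp_all add: Shat_zero Shat_add Shat_smult Shat_coord_closed)

text \<open>The coordinates are jointly injective homomorphisms to semimodules, so the axioms hold
  because they hold in each coordinate.\<close>

lemma Shat_semimodule: "semimodule S (Shat_semimodule S X)"
proof (rule semimodule_jointly_injective[OF S])
  show "semimodule S (snd i)" "(\<lambda>t. t i) \<in> semimodule_hom S (Shat_semimodule S X) (snd i)"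
    if "i \<in> comma_objects S X" for i
    using comma_objectsD(1) Shat_coord_hom that by (cases i; auto)+
qed (auto simp: Shat_zero Shat_add Shat_smult intro: Shat_eqI)

lemma Shat_boolean_space: "boolean_space (Shat S X)"
proof -
  have "(\<lambda>(\<phi>, Y). discrete_space Y) = (\<lambda>i :: ('s, 'x) comma_obj. discrete_topology (carrier (snd i)))"
    by auto
  then show ?thesis
    unfolding Shat_def using comma_objectsD(2)[of _ _ S X]
    by (auto intro!: boolean_space_limit)
qed

lemma Shat_coord_continuous:
  assumes "(\<phi>, Y) \<in> comma_objects S X"
  shows "continuous_map (Shat S X) (discrete_space Y) (\<lambda>t. t (\<phi>, Y))"
  using comma_objectsD(4)[OF Shat_proj_comma_object[OF assms]]
  by (rule continuous_map_eq) (simp add: Shat_proj_def)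

lemma Shat_coord_finite_quotient_map:
  assumes "(\<phi>, Y) \<in> comma_objects S X"
  shows "finite_quotient_map S (Shat_semimodule S X) (Shat S X) (\<lambda>t. t (\<phi>, Y))"
  by (rule finite_quotient_map_hom[OF Shat_coord_hom[OF assms] comma_objectsD(2)[OF assms]
        Shat_coord_continuous[OF assms]])

text \<open>Distinct points differ in some coordinate, and every coordinate is a finite quotient
  map.\<close>

lemma Shat_profinite:
  "profinite_semimodule TYPE((('s, 'x) profinite_point \<times> ('s, 'x) profinite_point) set)
     S (Shat_semimodule S X) (Shat S X)"
proof (rule profinite_semimoduleI[OF Shat_semimodule Shat_boolean_space])
  fix t u assume "t \<in> carrier (Shat_semimodule S X)" "u \<in> carrier (Shat_semimodule S X)" "t \<noteq> u"
  then obtain \<phi> Y where "(\<phi>, Y) \<in> comma_objects S X" "t (\<phi>, Y) \<noteq> u (\<phi>, Y)"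
    using Shat_eqI[of t S X u] by auto
  then show "\<exists>c. finite_quotient_map S (Shat_semimodule S X) (Shat S X) c \<and> c t \<noteq> c u"
    using Shat_coord_finite_quotient_map by blast
qed simp

section \<open>Freeness\<close>

text \<open>
  For \<open>d\<close> finer than the coordinates in \<open>F\<close>, the image of \<open>E\<close> under \<open>d\<close> is an object of the comma
  category, so the component of \<open>t\<close> there is \<open>d e\<close> for some \<open>e \<in> E\<close>.
\<close>

lemma Shat_approximation:
  assumes E: "subsemimodule S (Shat_semimodule S X) E" and unit: "Shat_unit S X ` topspace X \<subseteq> E"
    and t: "t \<in> topspace (Shat S X)" and F: "finite F" "F \<subseteq> comma_objects S X"
  shows "\<exists>e\<in>E. \<forall>i\<in>F. e i = t i"
proof -
  let ?M = "Shat_semimodule S X"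
  let ?E = "?M\<lparr>carrier := E\<rparr>"
  have EM: "E \<subseteq> topspace (Shat S X)" using E by (simp add: subsemimodule_def)
  \<comment> \<open>Finitely many coordinates are replaced by one quotient map \<open>d\<close> that
    determines them all.\<close>
  have "\<exists>d. finite_quotient_map S ?M (Shat S X) d \<and>
      (\<forall>c\<in>(\<lambda>i t. t i) ` F. \<forall>x y. d x = d y \<longrightarrow> c x = c y)"
    using F Shat_coord_finite_quotient_map
    by (intro finite_quotient_map_common_refinement) auto
  then obtain d where d: "finite_quotient_map S ?M (Shat S X) d"
    and sep: "\<And>i x y. i \<in> F \<Longrightarrow> d x = d y \<Longrightarrow> x i = y i"
    by auto
  \<comment> \<open>The image is taken of \<open>E\<close> rather than of the whole semimodule, so
    every element of its carrier is \<open>d e\<close> with \<open>e \<in> E\<close>.\<close>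
  let ?N = "semimodule_image ?E d"
  have sE: "semimodule S ?E" by (rule semimodule_subsemimodule[OF Shat_semimodule E])
  have cE: "congruent_map S ?E d"
    using d E by (intro congruent_map_subset) (simp_all add: finite_quotient_map_def)
  have dE: "d \<in> semimodule_hom S ?E ?N" by (rule semimodule_image_hom[OF cE])
  define \<psi> where "\<psi> = (\<lambda>x\<in>topspace X. d (Shat_unit S X x))"
  have "continuous_map X (discrete_space ?N) \<psi>"
  proof (rule continuous_map_discrete_image)
    have "continuous_map X (discrete_topology UNIV) (d \<circ> Shat_unit S X)"
      using d Shat_unit_continuous by (intro continuous_map_compose) (auto simp: finite_quotient_map_def)
    then show "continuous_map X (discrete_topology UNIV) \<psi>"
      by (rule continuous_map_eq) (simp add: \<psi>_def)
    show "\<psi> ` topspace X \<subseteq> carrier ?N" using unit by (auto simp: \<psi>_def)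
  qed
  moreover have "finite (d ` E)"
    using d EM by (auto simp: finite_quotient_map_def intro: finite_subset[OF image_mono])
  ultimately have \<psi>: "(\<psi>, ?N) \<in> comma_objects S X"
    using semimodule_image_semimodule[OF sE cE]
    by (auto simp: comma_objects_def finite_semimodules_def \<psi>_def)
  obtain e where e: "e \<in> E" "t (\<psi>, ?N) = d e"
    using Shat_coord_closed[OF t \<psi>] by auto
  have "e (\<phi>, Y) = t (\<phi>, Y)" if i: "(\<phi>, Y) \<in> F" for \<phi> Y
  proof -
    have \<phi>: "(\<phi>, Y) \<in> comma_objects S X" using i F by blast
    \<comment> \<open>The coordinate at \<open>(\<phi>, Y)\<close>, restricted to \<open>E\<close>,
      factors through \<open>d\<close> as \<open>m\<close>. Composed with the unit that coordinate
      is \<open>\<phi>\<close>, so \<open>m\<close> is an arrow of the comma category, and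
      compatibility of \<open>t\<close> along it carries \<open>d e\<close> to
      \<open>t (\<phi>, Y)\<close>.\<close>
    define m where "m a = inv_into (carrier ?E) d a (\<phi>, Y)" for a
    have h: "(\<lambda>t. t (\<phi>, Y)) \<in> semimodule_hom S ?E Y"
      using Shat_coord_hom[OF \<phi>] EM by (auto simp: semimodule_hom_def subset_iff)
    have m: "m (d x) = x (\<phi>, Y)" if "x \<in> E" for x
      using semimodule_hom_factor(1)[OF dE _ sE h] sep[OF i] that by (auto simp: m_def)
    have "m \<in> semimodule_hom S ?N Y"
      using semimodule_hom_factor(2)[OF dE _ sE h] sep[OF i] by (auto simp: m_def[abs_def])
    moreover have "m (\<psi> x) = \<phi> x" if "x \<in> topspace X" for x
      using that unit m \<phi> by (auto simp: \<psi>_def Shat_unit_def)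
    ultimately have "comma_arrow S X (\<psi>, ?N) (\<phi>, Y) m"
      by (simp add: comma_arrow_def)
    then have "m (t (\<psi>, ?N)) = t (\<phi>, Y)"
      using t \<psi> \<phi> unfolding topspace_Shat by blast
    then show ?thesis using m e by simp
  qed
  then have "\<forall>i\<in>F. e i = t i" by auto
  then show ?thesis using e(1) by blast
qed

text \<open>A basic neighbourhood constrains finitely many coordinates, so by
  \<open>Shat_approximation\<close> it meets \<open>E\<close>. Thus \<open>E\<close> is dense, and a
  closed dense set is the whole space.\<close>

lemma Shat_closed_subsemimodule:
  assumes E: "subsemimodule S (Shat_semimodule S X) E" and unit: "Shat_unit S X ` topspace X \<subseteq> E"
    and closed: "closedin (Shat S X) E"
  shows "E = topspace (Shat S X)"
proof (rule ccontr)
  let ?D = "\<lambda>(\<phi>, Y). discrete_space Y"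
  assume "E \<noteq> topspace (Shat S X)"
  then obtain t where t: "t \<in> topspace (Shat S X)" "t \<notin> E"
    using closedin_subset[OF closed] by blast
  have "openin (Shat S X) (topspace (Shat S X) - E)"
    using closed by (rule openin_diff[OF openin_topspace])
  moreover obtain K where Shat: "Shat S X = subtopology (product_topology ?D (comma_objects S X)) K"
    unfolding Shat_def limit_space_def by blast
  ultimately obtain W where W: "openin (product_topology ?D (comma_objects S X)) W"
      and K: "topspace (Shat S X) - E = W \<inter> K"
    by (auto simp: openin_subtopology)
  have "topspace (Shat S X) \<subseteq> K" unfolding Shat by simp
  note K = K this
  have "t \<in> W" using t K by blast
  then obtain U where U: "finite {i \<in> comma_objects S X. U i \<noteq> topspace (?D i)}"
      "t \<in> Pi\<^sub>E (comma_objects S X) U" "Pi\<^sub>E (comma_objects S X) U \<subseteq> W"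
    using W unfolding openin_product_topology_alt by meson
  then obtain e where e: "e \<in> E" "\<forall>i\<in>{i \<in> comma_objects S X. U i \<noteq> topspace (?D i)}. e i = t i"
    using Shat_approximation[OF E unit t(1) U(1)] by blast
  have eT: "e \<in> topspace (Shat S X)" using e(1) closedin_subset[OF closed] by blast
  \<comment> \<open>At the finitely many proper factors \<open>e\<close> agrees with
    \<open>t\<close>; at the others membership in the space suffices.\<close>
  have "e i \<in> U i" if "i \<in> comma_objects S X" for i
  proof (cases "U i = topspace (?D i)")
    case True
    then show ?thesis using Shat_coord_closed[OF eT] that by (cases i) auto
  next
    case False
    then have "e i = t i" using e(2) that by blast
    then show ?thesis using U(2) that by (auto simp: PiE_iff)
  qed
  then have "e \<in> Pi\<^sub>E (comma_objects S X) U"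
    using eT unfolding topspace_Shat PiE_iff by blast
  then show False using U(3) K e(1) eT by blast
qed

text \<open>The set of agreement is a subsemimodule, contains the image of the unit, and is closed
  because \<open>T\<close> is Hausdorff.\<close>

lemma Shat_hom_eq:
  assumes T: "Hausdorff_space T"
    and g: "g \<in> semimodule_hom S (Shat_semimodule S X) Y" "continuous_map (Shat S X) T g"
    and h: "h \<in> semimodule_hom S (Shat_semimodule S X) Y" "continuous_map (Shat S X) T h"
    and eq: "\<And>x. x \<in> topspace X \<Longrightarrow> g (Shat_unit S X x) = h (Shat_unit S X x)"
    and t: "t \<in> topspace (Shat S X)"
  shows "g t = h t"
proof -
  have "{t \<in> topspace (Shat S X). g t = h t} = topspace (Shat S X)"
  proof (rule Shat_closed_subsemimodule)
    show "subsemimodule S (Shat_semimodule S X) {t \<in> topspace (Shat S X). g t = h t}"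
      using subsemimodule_equalizer[OF Shat_semimodule g(1) h(1)] by simp
    show "Shat_unit S X ` topspace X \<subseteq> {t \<in> topspace (Shat S X). g t = h t}"
      using eq Shat_unit_closed by auto
    show "closedin (Shat S X) {t \<in> topspace (Shat S X). g t = h t}"
      by (rule closedin_continuous_maps_eq[OF T g(2) h(2)])
  qed
  then show ?thesis using t by blast
qed

text \<open>Each composite \<open>p i \<circ> f\<close> is a comma object, and the coordinates at
  these objects form a cone over the diagram of \<open>Y\<close>. The induced map \<open>g\<close>
  preserves the operations since the \<open>p i\<close> are jointly injective homomorphisms and each
  \<open>p i \<circ> g\<close> is a coordinate.\<close>

lemma Shat_extension:
  fixes Y :: "('s, 'y, 'f) module_scheme"
  assumes Y: "profinite_semimodule TYPE('i) S Y T" and f: "continuous_map X T f"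
  shows "\<exists>g. g \<in> extensional (topspace (Shat S X)) \<and> continuous_map (Shat S X) T g \<and>
    g \<in> semimodule_hom S (Shat_semimodule S X) Y \<and> (\<forall>x\<in>topspace X. g (Shat_unit S X x) = f x)"
proof -
  from Y obtain J :: "'i set" and r N tr p
    where sY: "semimodule S Y" and TY: "topspace T = carrier Y"
      and cod: "codirected_diagram S J r N tr" and p: "\<And>i. i \<in> J \<Longrightarrow> p i \<in> semimodule_hom S Y (N i)"
      and lim: "limit_cone J (\<lambda>i. discrete_space (N i)) (\<lambda>i j m. (i, j) \<in> r \<and> m = tr i j) T p"
    unfolding profinite_semimodule_def by blast
  \<comment> \<open>Restriction to \<open>topspace X\<close> is required because the maps in comma
    objects are extensional.\<close>
  define q where "q i = (\<lambda>x\<in>topspace X. p i (f x), N i)" for i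
  have fY: "f x \<in> carrier Y" if "x \<in> topspace X" for x
    using continuous_map_image_subset_topspace[OF f] TY that by blast
  have pT: "continuous_map T (discrete_space (N i)) (p i)" if "i \<in> J" for i
    using lim that by (simp add: limit_cone_def cone_def)
  have ptr: "tr i j (p i y) = p j y" if "(i, j) \<in> r" "i \<in> J" "j \<in> J" "y \<in> carrier Y" for i j y
    using lim that TY by (simp add: limit_cone_def cone_def)
  have q: "q i \<in> comma_objects S X" if "i \<in> J" for i
  proof -
    have "continuous_map X (discrete_space (N i)) (\<lambda>x\<in>topspace X. p i (f x))"
      using continuous_map_compose[OF f pT[OF that]] by (rule continuous_map_eq) simp
    then show ?thesis
      using cod that by (auto simp: q_def comma_objects_def codirected_diagram_def)
  qed
  have "cone J (\<lambda>i. discrete_space (N i)) (\<lambda>i j m. (i, j) \<in> r \<and> m = tr i j) (Shat S X) (\<lambda>i t. t (q i))"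
    unfolding cone_def
  proof (intro conjI ballI allI impI)
    show "continuous_map (Shat S X) (discrete_space (N i)) (\<lambda>t. t (q i))" if "i \<in> J" for i
      using q[OF that] unfolding q_def by (rule Shat_coord_continuous)
  next
    fix i j m t
    assume ij: "i \<in> J" "j \<in> J" "(i, j) \<in> r \<and> m = tr i j" and t: "t \<in> topspace (Shat S X)"
    \<comment> \<open>A transition map of the diagram is itself an arrow of the comma category, so
      the cone condition is an instance of the compatibility of \<open>t\<close>.\<close>
    have "comma_arrow S X (q i) (q j) m"
      using cod ij ptr fY by (auto simp: comma_arrow_def q_def codirected_diagram_def)
    then show "m (t (q i)) = t (q j)"
      using t q[OF ij(1)] q[OF ij(2)] unfolding topspace_Shat q_def by blast
  qed
  from limit_cone_universal[OF lim this] obtain g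
    where g: "g \<in> extensional (topspace (Shat S X))" "continuous_map (Shat S X) T g"
      and gp: "\<And>i t. i \<in> J \<Longrightarrow> t \<in> topspace (Shat S X) \<Longrightarrow> p i (g t) = t (q i)"
    by blast
  have gY: "g t \<in> carrier Y" if "t \<in> topspace (Shat S X)" for t
    using continuous_map_image_subset_topspace[OF g(2)] TY that by blast
  \<comment> \<open>The comparison map of a limit cone is a homeomorphism, in particular
    injective.\<close>
  have inj: "y = z" if "y \<in> carrier Y" "z \<in> carrier Y" "\<And>i. i \<in> J \<Longrightarrow> p i y = p i z" for y z
  proof -
    have "inj_on (\<lambda>y. \<lambda>i\<in>J. p i y) (topspace T)"
      using lim homeomorphic_imp_injective_map by (auto simp: limit_cone_def)
    moreover have "(\<lambda>i\<in>J. p i y) = (\<lambda>i\<in>J. p i z)" using that(3) by auto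
    ultimately show ?thesis using that(1,2) TY by (simp add: inj_on_def)
  qed
  note sYD = semimoduleD[OF sY]
  have qh: "(\<lambda>t. t (q i)) \<in> semimodule_hom S (Shat_semimodule S X) (N i)" if "i \<in> J" for i
    using q[OF that] unfolding q_def by (rule Shat_coord_hom)
  have "g \<in> semimodule_hom S (Shat_semimodule S X) Y"
  proof (rule semimodule_homI)
    fix t u assume tu: "t \<in> carrier (Shat_semimodule S X)" "u \<in> carrier (Shat_semimodule S X)"
    show "g (t \<oplus>\<^bsub>Shat_semimodule S X\<^esub> u) = g t \<oplus>\<^bsub>Y\<^esub> g u"
      using tu by (intro inj)
        (simp_all add: gY Shat_add sYD gp semimodule_homD(2)[OF p] semimodule_homD(2)[OF qh])
  next
    show "g \<zero>\<^bsub>Shat_semimodule S X\<^esub> = \<zero>\<^bsub>Y\<^esub>"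
      by (intro inj)
        (simp_all add: gY Shat_zero sYD gp semimodule_homD(3)[OF p] semimodule_homD(3)[OF qh])
  next
    fix s t assume st: "s \<in> carrier S" "t \<in> carrier (Shat_semimodule S X)"
    then show "g (s \<odot>\<^bsub>Shat_semimodule S X\<^esub> t) = s \<odot>\<^bsub>Y\<^esub> g t"
      by (intro inj)
        (simp_all add: gY Shat_smult sYD gp semimodule_homD(4)[OF p] semimodule_homD(4)[OF qh])
  qed (simp add: gY)
  moreover have "g (Shat_unit S X x) = f x" if x: "x \<in> topspace X" for x
  proof (rule inj)
    have u: "Shat_unit S X x \<in> topspace (Shat S X)"
      using x by (rule Shat_unit_closed)
    then show "g (Shat_unit S X x) \<in> carrier Y" by (rule gY)
    show "p i (g (Shat_unit S X x)) = p i (f x)" if "i \<in> J" for i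
      using gp[OF that u] q[OF that] x by (simp add: Shat_unit_def q_def)
  qed (use fY x in auto)
  ultimately show ?thesis using g by blast
qed

end

section \<open>The free profinite semimodule on a Boolean space\<close>

theorem corollary2p11:
  fixes S :: "('s, 'e) ring_scheme" and X :: "'x topology"
  assumes "semiring S" and "boolean_space X"
  shows "profinite_semimodule
           TYPE((('s, 'x) profinite_point \<times> ('s, 'x) profinite_point) set)
           S (Shat_semimodule S X) (Shat S X) \<and>
         (\<forall>(Y :: ('s, 'y, 'f) module_scheme) (T :: 'y topology) (f :: 'x \<Rightarrow> 'y).
            profinite_semimodule TYPE('i) S Y T \<longrightarrow> continuous_map X T f \<longrightarrow>
            (\<exists>!g. g \<in> extensional (topspace (Shat S X)) \<and>
                  continuous_map (Shat S X) T g \<and>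
                  g \<in> semimodule_hom S (Shat_semimodule S X) Y \<and>
                  (\<forall>x\<in>topspace X. g (Shat_unit S X x) = f x)))"
proof (intro conjI allI impI)
  fix Y :: "('s, 'y, 'f) module_scheme" and T :: "'y topology" and f :: "'x \<Rightarrow> 'y"
  assume Y: "profinite_semimodule TYPE('i) S Y T" and f: "continuous_map X T f"
  have T: "Hausdorff_space T"
    using Y by (simp add: profinite_semimodule_def boolean_space_def)
  show "\<exists>!g. g \<in> extensional (topspace (Shat S X)) \<and> continuous_map (Shat S X) T g \<and>
      g \<in> semimodule_hom S (Shat_semimodule S X) Y \<and>
      (\<forall>x\<in>topspace X. g (Shat_unit S X x) = f x)"
  proof (intro ex_ex1I[OF Shat_extension[OF assms(1) Y f]], elim conjE)
    fix g h
    assume g: "g \<in> extensional (topspace (Shat S X))" "continuous_map (Shat S X) T g"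
        "g \<in> semimodule_hom S (Shat_semimodule S X) Y"
        "\<forall>x\<in>topspace X. g (Shat_unit S X x) = f x"
      and h: "h \<in> extensional (topspace (Shat S X))" "continuous_map (Shat S X) T h"
        "h \<in> semimodule_hom S (Shat_semimodule S X) Y"
        "\<forall>x\<in>topspace X. h (Shat_unit S X x) = f x"
    show "g = h"
      using g(1) h(1)
    \<comment> \<open>Both maps are extensional, so agreement on the points of
      \<open>Shat S X\<close> makes them equal as functions.\<close>
    proof (rule extensionalityI)
      show "g t = h t" if "t \<in> topspace (Shat S X)" for t
        by (rule Shat_hom_eq[OF assms(1) T g(3,2) h(3,2) _ that]) (use g(4) h(4) in simp)
    qed
  qed
qed (rule Shat_profinite[OF assms(1)])

end
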